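(* Let $K$ be an algebraically closed field of characteristic $0$, let $A$ be a $\mathbb{Z}_2$-graded regular $K$-algebra with minimal regular decomposition, and let $C=C_0\oplus C_1$ be a finite dimensional $\mathbb{Z}_2$-graded algebra such that $T_{\mathbb{Z}_2}(E(C))=T_{\mathbb{Z}_2}(A)=T_{\mathbb{Z}_2}(E)$. Then the $\mathbb{Z}_2$-graded algebra $C$ is regular and commutative.
   Context: All algebras are associative unital algebras over $K$. A $\mathbb{Z}_2$-graded algebra $A=A_0\oplus A_1$ is regular if (i) for every $n\in\mathbb{N}$ and every $(g_1,\dots,g_n)\in\mathbb{Z}_2^n$ there exist $a_i\in A_{g_i}$ with $a_1\cdots a_n\neq0$; and (ii) for every $g,h\in\mathbb{Z}_2$ there is $\beta(g,h)\in K^*$ (depending only on $g,h$) with $a_ga_h=\beta(g,h)a_ha_g$ for all $a_g\in A_g$, $a_h\in A_h$. Its regular decomposition is minimal if there are no $h\ne k$ in $\mathbb{Z}_2$ with $\beta(g,h)=\beta(g,k)$ for all $g\in\mathbb{Z}_2$. $T_{\mathbb{Z}_2}(R)$ is the ideal of $\mathbb{Z}_2$-graded polynomial identities of $R$: the set of polynomials in the free $\mathbb{Z}_2$-graded algebra (infinitely many noncommuting variables of each degree) that vanish when the variables are replaced by arbitrary homogeneous elements of $R$ of the corresponding degrees. $E$ is the unital algebra generated by $e_1,e_2,\dots$ with relations $e_ie_j=-e_je_i$ for all $i,j$; $E_0$ (resp. $E_1$) is the span of monomials of even length, including $1$ (resp. odd length). The Grassmann envelope of $C$ is $E(C)=(C_0\otimes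 E_0)\oplus(C_1\otimes E_1)$, with degree $0$ and degree $1$ components these two summands. *)

theory Defs
  imports
    "HOL-Algebra.Algebra"
    "HOL-Algebra.Algebraic_Closure_Type"
    "HOL-Library.Poly_Mapping"
    "HOL-Library.Z2"
begin

section \<open>Associative unital algebras\<close>

text \<open>
  The base field is a type of class \<open>field\<close>, turned into a ring with carrier by
  \<open>ring_of_type_algebra\<close>. Algebras over it are \<open>module\<close> records, so they have
  arbitrary carriers. The library locale \<open>algebra\<close> is not used since it
  requires commutativity. The zero algebra is allowed.
\<close>

definition k_algebra :: "('k::field, 'a) module \<Rightarrow> bool" where
  "k_algebra A \<longleftrightarrow>
     ring A \<and> module (ring_of_type_algebra :: 'k ring) A \<and>
     (\<forall>k. \<forall>x\<in>carrier A. \<forall>y\<in>carrier A.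
        (k \<odot>\<^bsub>A\<^esub> x) \<otimes>\<^bsub>A\<^esub> y = k \<odot>\<^bsub>A\<^esub> (x \<otimes>\<^bsub>A\<^esub> y) \<and>
        x \<otimes>\<^bsub>A\<^esub> (k \<odot>\<^bsub>A\<^esub> y) = k \<odot>\<^bsub>A\<^esub> (x \<otimes>\<^bsub>A\<^esub> y))"

abbreviation subspace_of :: "'a set \<Rightarrow> ('k::field, 'a) module \<Rightarrow> bool" where
  "subspace_of H A \<equiv> submodule H (ring_of_type_algebra :: 'k ring) A"

definition lin_span :: "('k::field, 'a) module \<Rightarrow> 'a set \<Rightarrow> 'a set" where
  "lin_span A S = \<Inter>{H. subspace_of H A \<and> S \<subseteq> H}"

definition finite_dim :: "('k::field, 'a) module \<Rightarrow> bool" where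
  "finite_dim A \<longleftrightarrow> (\<exists>S. finite S \<and> S \<subseteq> carrier A \<and> lin_span A S = carrier A)"

definition list_prod :: "('a, 'm) monoid_scheme \<Rightarrow> 'a list \<Rightarrow> 'a" where
  "list_prod A xs = foldr (\<lambda>x y. x \<otimes>\<^bsub>A\<^esub> y) xs \<one>\<^bsub>A\<^esub>"


section \<open>Graded algebras\<close>

text \<open>The grading group \<open>\<int>\<^sub>2\<close> is the type \<open>bit\<close>; \<open>G g\<close> is the component of degree \<open>g\<close>.\<close>

definition graded_algebra :: "('k::field, 'a) module \<Rightarrow> (bit \<Rightarrow> 'a set) \<Rightarrow> bool" where
  "graded_algebra A G \<longleftrightarrow>
     k_algebra A \<and>
     (\<forall>g. subspace_of (G g) A) \<and>
     (\<forall>x\<in>carrier A. \<exists>!(x0, x1). x0 \<in> G 0 \<and> x1 \<in> G 1 \<and> x = x0 \<oplus>\<^bsub>A\<^esub> x1) \<and>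
     (\<forall>g h. \<forall>x\<in>G g. \<forall>y\<in>G h. x \<otimes>\<^bsub>A\<^esub> y \<in> G (g + h))"

definition commutation_function ::
    "('k::field, 'a) module \<Rightarrow> (bit \<Rightarrow> 'a set) \<Rightarrow> (bit \<Rightarrow> bit \<Rightarrow> 'k) \<Rightarrow> bool" where
  "commutation_function A G \<beta> \<longleftrightarrow>
     (\<forall>g h. \<beta> g h \<noteq> 0 \<and>
        (\<forall>x\<in>G g. \<forall>y\<in>G h. x \<otimes>\<^bsub>A\<^esub> y = \<beta> g h \<odot>\<^bsub>A\<^esub> (y \<otimes>\<^bsub>A\<^esub> x)))"

definition regular :: "('k::field, 'a) module \<Rightarrow> (bit \<Rightarrow> 'a set) \<Rightarrow> bool" where
  "regular A G \<longleftrightarrow>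
     graded_algebra A G \<and>
     (\<forall>gs. \<exists>as. list_all2 (\<lambda>g a. a \<in> G g) gs as \<and> list_prod A as \<noteq> \<zero>\<^bsub>A\<^esub>) \<and>
     (\<exists>\<beta>. commutation_function A G \<beta>)"

text \<open>For a regular algebra the commutation function is unique, so quantifying it
  existentially here refers to the same function as in \<open>regular\<close>.\<close>

definition minimal_decomposition :: "('k::field, 'a) module \<Rightarrow> (bit \<Rightarrow> 'a set) \<Rightarrow> bool" where
  "minimal_decomposition A G \<longleftrightarrow>
     (\<exists>\<beta>. commutation_function A G \<beta> \<and>
        \<not> (\<exists>h k. h \<noteq> k \<and> (\<forall>g. \<beta> g h = \<beta> g k)))"


section \<open>Monoid algebras and quotients\<close>

definition monoid_algebra :: "('m, 'r) monoid_scheme \<Rightarrow> ('k::field, 'm \<Rightarrow>\<^sub>0 'k) module" where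
  "monoid_algebra M =
     \<lparr>carrier = {p. Poly_Mapping.keys p \<subseteq> carrier M},
      monoid.mult = (\<lambda>p q. \<Sum>x\<in>Poly_Mapping.keys p. \<Sum>y\<in>Poly_Mapping.keys q.
         Poly_Mapping.single (x \<otimes>\<^bsub>M\<^esub> y) (Poly_Mapping.lookup p x * Poly_Mapping.lookup q y)),
      one = Poly_Mapping.single \<one>\<^bsub>M\<^esub> 1,
      ring.zero = 0,
      add = (\<lambda>p q. p + q),
      module.smult = (\<lambda>k p. Poly_Mapping.map (\<lambda>c. k * c) p)\<rparr>"

definition quotient_algebra :: "('k::field, 'a) module \<Rightarrow> 'a set \<Rightarrow> ('k, 'a set) module" where
  "quotient_algebra A I =
     ring.extend (A Quot I) \<lparr>module.smult = (\<lambda>k S. \<Union>x\<in>S. I +>\<^bsub>A\<^esub> (k \<odot>\<^bsub>A\<^esub> x))\<rparr>"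

definition free_monoid :: "'x list monoid" where
  "free_monoid = \<lparr>carrier = UNIV, monoid.mult = (@), one = []\<rparr>"

abbreviation free_algebra :: "('k::field, 'x list \<Rightarrow>\<^sub>0 'k) module" where
  "free_algebra \<equiv> monoid_algebra free_monoid"


section \<open>Graded polynomial identities\<close>

text \<open>The free \<open>\<int>\<^sub>2\<close>-graded algebra is the free algebra on the variables \<open>(g, i)\<close>,
  the \<open>i\<close>-th variable of degree \<open>g\<close>.\<close>

definition eval_poly ::
    "('k::field, 'a) module \<Rightarrow> ('x \<Rightarrow> 'a) \<Rightarrow> ('x list \<Rightarrow>\<^sub>0 'k) \<Rightarrow> 'a" where
  "eval_poly A \<phi> p =
     (\<Oplus>\<^bsub>A\<^esub>w\<in>Poly_Mapping.keys p. Poly_Mapping.lookup p w \<odot>\<^bsub>A\<^esub> list_prod A (map \<phi> w))"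

definition graded_identities ::
    "('k::field, 'a) module \<Rightarrow> (bit \<Rightarrow> 'a set) \<Rightarrow> ((bit \<times> nat) list \<Rightarrow>\<^sub>0 'k) set" where
  "graded_identities A G =
     {p \<in> carrier free_algebra.
        \<forall>\<phi>. (\<forall>g i. \<phi> (g, i) \<in> G g) \<longrightarrow> eval_poly A \<phi> p = \<zero>\<^bsub>A\<^esub>}"


section \<open>The Grassmann algebra\<close>

type_synonym 'k grassmann = "(nat list \<Rightarrow>\<^sub>0 'k) set"

definition grassmann_ideal :: "(nat list \<Rightarrow>\<^sub>0 'k::field) set" where
  "grassmann_ideal = genideal free_algebra
     {Poly_Mapping.single [i, j] 1 + Poly_Mapping.single [j, i] 1 | i j. True}"

definition grassmann_algebra :: "('k::field, 'k grassmann) module" where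
  "grassmann_algebra = quotient_algebra free_algebra grassmann_ideal"

definition grassmann_monomial :: "nat list \<Rightarrow> 'k::field grassmann" where
  "grassmann_monomial w = grassmann_ideal +>\<^bsub>free_algebra\<^esub> Poly_Mapping.single w 1"

definition grassmann_component :: "bit \<Rightarrow> 'k::field grassmann set" where
  "grassmann_component g =
     lin_span grassmann_algebra {grassmann_monomial w | w. of_nat (length w) = g}"


section \<open>Tensor products and the Grassmann envelope\<close>

text \<open>
  The tensor product of two algebras is the vector space with basis
  \<open>carrier A \<times> carrier B\<close> modulo the bilinearity relations. With the componentwise
  product on the basis this vector space is the monoid algebra of \<open>A \<times>\<times> B\<close>. The
  product of a relation with a basis element, on either side, is again a relation, so the ideal
  generated by the relations is just their linear span.
\<close>

definition tensor_relations ::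
    "('k::field, 'a) module \<Rightarrow> ('k, 'b) module \<Rightarrow> ('a \<times> 'b \<Rightarrow>\<^sub>0 'k) set" where
  "tensor_relations A B =
     {Poly_Mapping.single (x \<oplus>\<^bsub>A\<^esub> x', y) 1 - Poly_Mapping.single (x, y) 1
        - Poly_Mapping.single (x', y) 1 | x x' y.
        x \<in> carrier A \<and> x' \<in> carrier A \<and> y \<in> carrier B} \<union>
     {Poly_Mapping.single (x, y \<oplus>\<^bsub>B\<^esub> y') 1 - Poly_Mapping.single (x, y) 1
        - Poly_Mapping.single (x, y') 1 | x y y'.
        x \<in> carrier A \<and> y \<in> carrier B \<and> y' \<in> carrier B} \<union>
     {Poly_Mapping.single (k \<odot>\<^bsub>A\<^esub> x, y) 1 - Poly_Mapping.single (x, y) k | k x y.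
        x \<in> carrier A \<and> y \<in> carrier B} \<union>
     {Poly_Mapping.single (x, k \<odot>\<^bsub>B\<^esub> y) 1 - Poly_Mapping.single (x, y) k | k x y.
        x \<in> carrier A \<and> y \<in> carrier B}"

definition tensor_ideal ::
    "('k::field, 'a) module \<Rightarrow> ('k, 'b) module \<Rightarrow> ('a \<times> 'b \<Rightarrow>\<^sub>0 'k) set" where
  "tensor_ideal A B = genideal (monoid_algebra (A \<times>\<times> B)) (tensor_relations A B)"

definition tensor_algebra ::
    "('k::field, 'a) module \<Rightarrow> ('k, 'b) module \<Rightarrow> ('k, ('a \<times> 'b \<Rightarrow>\<^sub>0 'k) set) module" where
  "tensor_algebra A B = quotient_algebra (monoid_algebra (A \<times>\<times> B)) (tensor_ideal A B)"

definition pure_tensor ::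
    "('k::field, 'a) module \<Rightarrow> ('k, 'b) module \<Rightarrow> 'a \<Rightarrow> 'b \<Rightarrow> ('a \<times> 'b \<Rightarrow>\<^sub>0 'k) set" where
  "pure_tensor A B x y =
     tensor_ideal A B +>\<^bsub>monoid_algebra (A \<times>\<times> B)\<^esub> Poly_Mapping.single (x, y) 1"

definition envelope_component ::
    "('k::field, 'c) module \<Rightarrow> (bit \<Rightarrow> 'c set) \<Rightarrow> bit \<Rightarrow> ('c \<times> 'k grassmann \<Rightarrow>\<^sub>0 'k) set set" where
  "envelope_component C G g =
     lin_span (tensor_algebra C grassmann_algebra)
       {pure_tensor C grassmann_algebra x y | x y. x \<in> G g \<and> y \<in> grassmann_component g}"

definition grassmann_envelope ::
    "('k::field, 'c) module \<Rightarrow> (bit \<Rightarrow> 'c set) \<Rightarrow> ('k, ('c \<times> 'k grassmann \<Rightarrow>\<^sub>0 'k) set) module" where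
  "grassmann_envelope C G =
     tensor_algebra C grassmann_algebra
       \<lparr>carrier := envelope_component C G 0
          <+>\<^bsub>tensor_algebra C grassmann_algebra\<^esub> envelope_component C G 1\<rparr>"


section \<open>The constructions yield algebras\<close>

lemma monoid_algebra_simps:
  "carrier (monoid_algebra M) = {p. Poly_Mapping.keys p \<subseteq> carrier M}"
  "\<zero>\<^bsub>monoid_algebra M\<^esub> = 0"
  "\<one>\<^bsub>monoid_algebra M\<^esub> = Poly_Mapping.single \<one>\<^bsub>M\<^esub> 1"
  "p \<oplus>\<^bsub>monoid_algebra M\<^esub> q = p + q"
  "k \<odot>\<^bsub>monoid_algebra M\<^esub> p = Poly_Mapping.map (\<lambda>c. k * c) p"
  by (simp_all add: monoid_algebra_def)

lemma monoid_algebra_mult: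
  fixes p q :: "'m \<Rightarrow>\<^sub>0 'k::field"
  assumes "finite S" "Poly_Mapping.keys p \<subseteq> S" "finite T" "Poly_Mapping.keys q \<subseteq> T"
  shows "p \<otimes>\<^bsub>monoid_algebra M\<^esub> q = (\<Sum>x\<in>S. \<Sum>y\<in>T.
    Poly_Mapping.single (x \<otimes>\<^bsub>M\<^esub> y) (Poly_Mapping.lookup p x * Poly_Mapping.lookup q y))"
proof -
  have "p \<otimes>\<^bsub>monoid_algebra M\<^esub> q = (\<Sum>x\<in>Poly_Mapping.keys p. \<Sum>y\<in>T.
    Poly_Mapping.single (x \<otimes>\<^bsub>M\<^esub> y) (Poly_Mapping.lookup p x * Poly_Mapping.lookup q y))"
    unfolding monoid_algebra_def monoid.simps using assms
    by - (rule sum.cong[OF refl], rule sum.mono_neutral_left, auto simp: in_keys_iff)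
  also have "\<dots> = (\<Sum>x\<in>S. \<Sum>y\<in>T.
    Poly_Mapping.single (x \<otimes>\<^bsub>M\<^esub> y) (Poly_Mapping.lookup p x * Poly_Mapping.lookup q y))"
    using assms by - (rule sum.mono_neutral_left, auto simp: in_keys_iff)
  finally show ?thesis .
qed

lemma monoid_algebra_distrib_right:
  fixes p q r :: "'m \<Rightarrow>\<^sub>0 'k::field"
  shows "(p + q) \<otimes>\<^bsub>monoid_algebra M\<^esub> r
     = p \<otimes>\<^bsub>monoid_algebra M\<^esub> r + q \<otimes>\<^bsub>monoid_algebra M\<^esub> r"
proof -
  let ?S = "Poly_Mapping.keys p \<union> Poly_Mapping.keys q"
  note * = monoid_algebra_mult[of ?S _ "Poly_Mapping.keys r" r M]
  show ?thesis
    by (subst (1 2 3) *) (use keys_add[of p q] in \<open>auto simp: lookup_add distrib_right single_add sum.distrib\<close>)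
qed

lemma monoid_algebra_distrib_left:
  fixes p q r :: "'m \<Rightarrow>\<^sub>0 'k::field"
  shows "r \<otimes>\<^bsub>monoid_algebra M\<^esub> (p + q)
     = r \<otimes>\<^bsub>monoid_algebra M\<^esub> p + r \<otimes>\<^bsub>monoid_algebra M\<^esub> q"
proof -
  let ?S = "Poly_Mapping.keys p \<union> Poly_Mapping.keys q"
  note * = monoid_algebra_mult[of "Poly_Mapping.keys r" r ?S _ M]
  show ?thesis
    by (subst (1 2 3) *) (use keys_add[of p q] in \<open>auto simp: lookup_add distrib_left single_add sum.distrib\<close>)
qed

lemma monoid_algebra_zero_mult:
  "(0 :: 'm \<Rightarrow>\<^sub>0 'k::field) \<otimes>\<^bsub>monoid_algebra M\<^esub> p = 0"
  "p \<otimes>\<^bsub>monoid_algebra M\<^esub> (0 :: 'm \<Rightarrow>\<^sub>0 'k::field) = 0"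
  by (simp_all add: monoid_algebra_def)

lemma monoid_algebra_sum_mult:
  fixes f :: "'i \<Rightarrow> 'm \<Rightarrow>\<^sub>0 'k::field"
  shows "sum f I \<otimes>\<^bsub>monoid_algebra M\<^esub> p = (\<Sum>i\<in>I. f i \<otimes>\<^bsub>monoid_algebra M\<^esub> p)"
    and "p \<otimes>\<^bsub>monoid_algebra M\<^esub> sum f I = (\<Sum>i\<in>I. p \<otimes>\<^bsub>monoid_algebra M\<^esub> f i)"
  by (induction I rule: infinite_finite_induct)
     (auto simp: monoid_algebra_zero_mult monoid_algebra_distrib_left monoid_algebra_distrib_right)

lemma monoid_algebra_single_mult:
  "Poly_Mapping.single x (a::'k::field) \<otimes>\<^bsub>monoid_algebra M\<^esub> Poly_Mapping.single y b
     = Poly_Mapping.single (x \<otimes>\<^bsub>M\<^esub> y) (a * b)"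
  by (simp add: monoid_algebra_mult[of "{x}" _ "{y}"])

lemma poly_mapping_eq_sum_single:
  fixes p :: "'m \<Rightarrow>\<^sub>0 'k::field"
  shows "p = (\<Sum>x\<in>Poly_Mapping.keys p. Poly_Mapping.single x (Poly_Mapping.lookup p x))"
  by (rule poly_mapping_eqI)
     (auto simp: lookup_sum lookup_single when_def sum.delta in_keys_iff)

lemma keys_sum_subset:
  assumes "\<And>i. i \<in> I \<Longrightarrow> Poly_Mapping.keys (f i) \<subseteq> S"
  shows "Poly_Mapping.keys (sum f I) \<subseteq> S"
  using assms
proof (induction I rule: infinite_finite_induct)
  case (insert x F)
  then show ?case using keys_add[of "f x" "sum f F"] by force
qed auto

lemma lookup_map:
  "f 0 = 0 \<Longrightarrow> Poly_Mapping.lookup (Poly_Mapping.map f p) x = f (Poly_Mapping.lookup p x)"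
  by (simp add: map.rep_eq when_def)

lemma smult_lookup:
  "Poly_Mapping.lookup (Poly_Mapping.map (\<lambda>c. (k::'k::field) * c) p) x = k * Poly_Mapping.lookup p x"
  by (simp add: map.rep_eq when_def)

lemma smult_mult:
  fixes p q :: "'m \<Rightarrow>\<^sub>0 'k::field"
  shows "Poly_Mapping.map (\<lambda>c. k * c) p \<otimes>\<^bsub>monoid_algebra M\<^esub> q
      = Poly_Mapping.map (\<lambda>c. k * c) (p \<otimes>\<^bsub>monoid_algebra M\<^esub> q)"
    and "p \<otimes>\<^bsub>monoid_algebra M\<^esub> Poly_Mapping.map (\<lambda>c. k * c) q
      = Poly_Mapping.map (\<lambda>c. k * c) (p \<otimes>\<^bsub>monoid_algebra M\<^esub> q)"
proof -
  have k: "Poly_Mapping.keys (Poly_Mapping.map (\<lambda>c. k * c) r) \<subseteq> Poly_Mapping.keys r" for r :: "'m \<Rightarrow>\<^sub>0 'k"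
    by (auto simp: in_keys_iff smult_lookup)
  note * = monoid_algebra_mult[of "Poly_Mapping.keys p" _ "Poly_Mapping.keys q" _ M]
  show "Poly_Mapping.map (\<lambda>c. k * c) p \<otimes>\<^bsub>monoid_algebra M\<^esub> q
      = Poly_Mapping.map (\<lambda>c. k * c) (p \<otimes>\<^bsub>monoid_algebra M\<^esub> q)"
    by (subst (1 2) *)
       (auto simp: k lookup_sum smult_lookup lookup_single when_def sum_distrib_left
          intro!: poly_mapping_eqI sum.cong)
  show "p \<otimes>\<^bsub>monoid_algebra M\<^esub> Poly_Mapping.map (\<lambda>c. k * c) q
      = Poly_Mapping.map (\<lambda>c. k * c) (p \<otimes>\<^bsub>monoid_algebra M\<^esub> q)"
    by (subst (1 2) *)
       (auto simp: k lookup_sum smult_lookup lookup_single when_def sum_distrib_left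
          intro!: poly_mapping_eqI sum.cong)
qed

lemma monoid_algebra_k_algebra:
  assumes "monoid M"
  shows "k_algebra (monoid_algebra M :: ('k::field, 'm \<Rightarrow>\<^sub>0 'k) module)"
proof -
  interpret M: monoid M by fact
  let ?A = "monoid_algebra M :: ('k, 'm \<Rightarrow>\<^sub>0 'k) module"
  have closed: "p \<otimes>\<^bsub>?A\<^esub> q \<in> carrier ?A" if "p \<in> carrier ?A" "q \<in> carrier ?A" for p q
  proof -
    have "Poly_Mapping.keys (p \<otimes>\<^bsub>?A\<^esub> q) \<subseteq> carrier M"
      unfolding monoid_algebra_mult[OF finite_keys order_refl finite_keys order_refl]
      using that by (intro keys_sum_subset) (auto simp: monoid_algebra_simps)
    then show ?thesis by (simp add: monoid_algebra_simps)
  qed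
  have ab: "abelian_group ?A"
  proof (rule abelian_groupI)
    fix x assume "x \<in> carrier ?A"
    then show "\<exists>y\<in>carrier ?A. y \<oplus>\<^bsub>?A\<^esub> x = \<zero>\<^bsub>?A\<^esub>"
      by (intro bexI[of _ "- x"]) (auto simp: monoid_algebra_simps)
  next
    fix x y assume "x \<in> carrier ?A" "y \<in> carrier ?A"
    then show "x \<oplus>\<^bsub>?A\<^esub> y \<in> carrier ?A"
      using keys_add[of x y] by (auto simp: monoid_algebra_simps)
  qed (simp_all add: monoid_algebra_simps add_ac)
  have mon: "monoid ?A"
  proof (rule monoidI)
    fix p q r assume pqr: "p \<in> carrier ?A" "q \<in> carrier ?A" "r \<in> carrier ?A"
    have "(p \<otimes>\<^bsub>?A\<^esub> q) \<otimes>\<^bsub>?A\<^esub> r = p \<otimes>\<^bsub>?A\<^esub> (q \<otimes>\<^bsub>?A\<^esub> r)"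
      apply (subst (1 2) poly_mapping_eq_sum_single[of p])
      apply (subst (1 2) poly_mapping_eq_sum_single[of q])
      apply (subst (1 2) poly_mapping_eq_sum_single[of r])
      unfolding monoid_algebra_sum_mult monoid_algebra_single_mult mult.assoc
      using pqr by (auto simp: monoid_algebra_simps subset_iff M.m_assoc intro!: sum.cong[OF refl])
    then show "p \<otimes>\<^bsub>?A\<^esub> q \<otimes>\<^bsub>?A\<^esub> r = p \<otimes>\<^bsub>?A\<^esub> (q \<otimes>\<^bsub>?A\<^esub> r)" .
  next
    fix p assume p: "p \<in> carrier ?A"
    let ?p = "\<Sum>x\<in>Poly_Mapping.keys p. Poly_Mapping.single x (Poly_Mapping.lookup p x)"
    note eq = poly_mapping_eq_sum_single[of p, symmetric]
    have "\<one>\<^bsub>?A\<^esub> \<otimes>\<^bsub>?A\<^esub> ?p = ?p"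
      unfolding monoid_algebra_simps monoid_algebra_sum_mult monoid_algebra_single_mult
      by (rule sum.cong) (use p in \<open>auto simp: monoid_algebra_simps\<close>)
    then show "\<one>\<^bsub>?A\<^esub> \<otimes>\<^bsub>?A\<^esub> p = p" unfolding eq .
    have "?p \<otimes>\<^bsub>?A\<^esub> \<one>\<^bsub>?A\<^esub> = ?p"
      unfolding monoid_algebra_simps monoid_algebra_sum_mult monoid_algebra_single_mult
      by (rule sum.cong) (use p in \<open>auto simp: monoid_algebra_simps\<close>)
    then show "p \<otimes>\<^bsub>?A\<^esub> \<one>\<^bsub>?A\<^esub> = p" unfolding eq .
  next
    show "\<one>\<^bsub>?A\<^esub> \<in> carrier ?A" by (simp add: monoid_algebra_simps)
  qed (rule closed)
  have "ring ?A"
    by (rule ringI[OF ab mon])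
       (simp_all add: monoid_algebra_simps monoid_algebra_distrib_left monoid_algebra_distrib_right)
  moreover have "module (ring_of_type_algebra :: 'k ring) ?A"
    by (rule moduleI[OF cring_from_type_algebra ab])
       (auto simp: monoid_algebra_simps ring_of_type_algebra_def in_keys_iff lookup_map
          lookup_add algebra_simps intro!: poly_mapping_eqI)
  ultimately show ?thesis
    unfolding k_algebra_def by (auto simp: monoid_algebra_simps(5) smult_mult)
qed

lemma
  assumes "k_algebra (A :: ('k::field, 'a) module)" and "ideal I A"
  shows quotient_algebra_k_algebra: "k_algebra (quotient_algebra A I)"
    and quotient_algebra_add: "x \<in> carrier A \<Longrightarrow> y \<in> carrier A \<Longrightarrow>
      (I +>\<^bsub>A\<^esub> x) \<oplus>\<^bsub>quotient_algebra A I\<^esub> (I +>\<^bsub>A\<^esub> y) = I +>\<^bsub>A\<^esub> (x \<oplus>\<^bsub>A\<^esub> y)"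
    and quotient_algebra_mult: "x \<in> carrier A \<Longrightarrow> y \<in> carrier A \<Longrightarrow>
      (I +>\<^bsub>A\<^esub> x) \<otimes>\<^bsub>quotient_algebra A I\<^esub> (I +>\<^bsub>A\<^esub> y) = I +>\<^bsub>A\<^esub> (x \<otimes>\<^bsub>A\<^esub> y)"
    and quotient_algebra_smult: "x \<in> carrier A \<Longrightarrow>
      k \<odot>\<^bsub>quotient_algebra A I\<^esub> (I +>\<^bsub>A\<^esub> x) = I +>\<^bsub>A\<^esub> (k \<odot>\<^bsub>A\<^esub> x)"
    and quotient_algebra_zero_iff: "x \<in> carrier A \<Longrightarrow>
      I +>\<^bsub>A\<^esub> x = \<zero>\<^bsub>quotient_algebra A I\<^esub> \<longleftrightarrow> x \<in> I"
proof -
  interpret A: ring A using assms(1) by (simp add: k_algebra_def)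
  interpret I: ideal I A by fact
  interpret Q: ring "A Quot I" by (rule I.quotient_is_ring)
  interpret m: module "ring_of_type_algebra :: 'k ring" A
    using assms(1) by (simp add: k_algebra_def)
  let ?Q = "quotient_algebra A I"
  have sm: "k \<odot>\<^bsub>A\<^esub> x \<in> carrier A" if "x \<in> carrier A" for k x
    using m.smult_closed[of k x] that by (simp add: ring_of_type_algebra_def)
  have compat: "(k \<odot>\<^bsub>A\<^esub> x) \<otimes>\<^bsub>A\<^esub> y = k \<odot>\<^bsub>A\<^esub> (x \<otimes>\<^bsub>A\<^esub> y)"
    "x \<otimes>\<^bsub>A\<^esub> (k \<odot>\<^bsub>A\<^esub> y) = k \<odot>\<^bsub>A\<^esub> (x \<otimes>\<^bsub>A\<^esub> y)"
    if "x \<in> carrier A" "y \<in> carrier A" for k x y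
    using assms(1) that by (auto simp: k_algebra_def)
  have q: "carrier ?Q = (\<lambda>x. I +>\<^bsub>A\<^esub> x) ` carrier A" "\<zero>\<^bsub>?Q\<^esub> = I" "\<one>\<^bsub>?Q\<^esub> = I +>\<^bsub>A\<^esub> \<one>\<^bsub>A\<^esub>"
    "S \<otimes>\<^bsub>?Q\<^esub> T = S \<otimes>\<^bsub>A Quot I\<^esub> T" "S \<oplus>\<^bsub>?Q\<^esub> T = S \<oplus>\<^bsub>A Quot I\<^esub> T" for S T
    by (auto simp: quotient_algebra_def ring.defs FactRing_simps)
  have add: "(I +>\<^bsub>A\<^esub> x) \<oplus>\<^bsub>?Q\<^esub> (I +>\<^bsub>A\<^esub> y) = I +>\<^bsub>A\<^esub> (x \<oplus>\<^bsub>A\<^esub> y)"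
    and mult: "(I +>\<^bsub>A\<^esub> x) \<otimes>\<^bsub>?Q\<^esub> (I +>\<^bsub>A\<^esub> y) = I +>\<^bsub>A\<^esub> (x \<otimes>\<^bsub>A\<^esub> y)"
    if "x \<in> carrier A" "y \<in> carrier A" for x y
    using that by (auto simp: q FactRing_def I.a_rcos_sum I.rcoset_mult_add)
  have smult: "k \<odot>\<^bsub>?Q\<^esub> (I +>\<^bsub>A\<^esub> x) = I +>\<^bsub>A\<^esub> (k \<odot>\<^bsub>A\<^esub> x)" if x: "x \<in> carrier A" for k x
  proof -
    have "I +>\<^bsub>A\<^esub> (k \<odot>\<^bsub>A\<^esub> y) = I +>\<^bsub>A\<^esub> (k \<odot>\<^bsub>A\<^esub> x)" if "y \<in> I +>\<^bsub>A\<^esub> x" for y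
    proof -
      from that obtain i where i: "i \<in> I" "y = i \<oplus>\<^bsub>A\<^esub> x"
        by (auto simp: a_r_coset_def r_coset_def)
      have ic: "i \<in> carrier A" using i by simp
      have "k \<odot>\<^bsub>A\<^esub> i = (k \<odot>\<^bsub>A\<^esub> \<one>\<^bsub>A\<^esub>) \<otimes>\<^bsub>A\<^esub> i"
        using compat(1)[of "\<one>\<^bsub>A\<^esub>" i k] ic by simp
      then have ki: "k \<odot>\<^bsub>A\<^esub> i \<in> I"
        using I.I_l_closed[OF i(1), of "k \<odot>\<^bsub>A\<^esub> \<one>\<^bsub>A\<^esub>"] sm by simp
      have "k \<odot>\<^bsub>A\<^esub> y = k \<odot>\<^bsub>A\<^esub> i \<oplus>\<^bsub>A\<^esub> k \<odot>\<^bsub>A\<^esub> x"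
        using m.smult_r_distr[of k i x] ic x i(2) by (simp add: ring_of_type_algebra_def)
      then have "k \<odot>\<^bsub>A\<^esub> y \<in> I +>\<^bsub>A\<^esub> (k \<odot>\<^bsub>A\<^esub> x)"
        using ki by (auto simp: a_r_coset_def r_coset_def)
      then show ?thesis
        using A.a_repr_independence[of _ I "k \<odot>\<^bsub>A\<^esub> x", OF _ sm[OF x] I.a_subgroup] by simp
    qed
    note * = this
    have "k \<odot>\<^bsub>?Q\<^esub> (I +>\<^bsub>A\<^esub> x) = (\<Union>y\<in>I +>\<^bsub>A\<^esub> x. I +>\<^bsub>A\<^esub> (k \<odot>\<^bsub>A\<^esub> y))"
      by (simp add: quotient_algebra_def ring.defs)
    also have "\<dots> = (\<Union>y\<in>I +>\<^bsub>A\<^esub> x. I +>\<^bsub>A\<^esub> (k \<odot>\<^bsub>A\<^esub> x))"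
      using * by (intro SUP_cong refl)
    also have "\<dots> = I +>\<^bsub>A\<^esub> (k \<odot>\<^bsub>A\<^esub> x)"
      using I.a_rcos_self[OF x] by blast
    finally show ?thesis .
  qed
  have Qc: "carrier ?Q = carrier (A Quot I)" "\<zero>\<^bsub>?Q\<^esub> = \<zero>\<^bsub>A Quot I\<^esub>" "\<one>\<^bsub>?Q\<^esub> = \<one>\<^bsub>A Quot I\<^esub>"
    by (auto simp: quotient_algebra_def ring.defs)
  have ab: "abelian_group ?Q"
  proof (rule abelian_groupI)
    fix S assume "S \<in> carrier ?Q"
    then show "\<exists>T\<in>carrier ?Q. T \<oplus>\<^bsub>?Q\<^esub> S = \<zero>\<^bsub>?Q\<^esub>"
      using Q.l_neg[of S] Q.a_inv_closed[of S] by (auto simp only: Qc q(5))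
  qed (simp_all only: Qc q(5) Q.a_closed Q.zero_closed Q.add.m_ac Q.l_zero Q.r_zero)
  have "ring ?Q"
  proof (rule ringI[OF ab])
    show "monoid ?Q"
      by (rule monoidI) (simp_all only: Qc q(4) Q.m_assoc Q.m_closed Q.one_closed Q.l_one Q.r_one)
  qed (simp_all only: Qc q(4,5) Q.l_distr Q.r_distr)
  moreover have "module (ring_of_type_algebra :: 'k ring) ?Q"
  proof (rule moduleI[OF cring_from_type_algebra ab])
  qed (use m.smult_l_distr m.smult_r_distr m.smult_assoc1 m.smult_one
       in \<open>auto simp: q(1) smult sm add ring_of_type_algebra_def\<close>)
  ultimately show "k_algebra ?Q"
    unfolding k_algebra_def by (auto simp: q(1) smult mult compat sm)
  show "I +>\<^bsub>A\<^esub> x = \<zero>\<^bsub>?Q\<^esub> \<longleftrightarrow> x \<in> I" if "x \<in> carrier A" for x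
    using that I.a_rcos_const I.a_rcos_self[of x] by (auto simp: q(2))
  show "(I +>\<^bsub>A\<^esub> x) \<oplus>\<^bsub>?Q\<^esub> (I +>\<^bsub>A\<^esub> y) = I +>\<^bsub>A\<^esub> (x \<oplus>\<^bsub>A\<^esub> y)"
    and "(I +>\<^bsub>A\<^esub> x) \<otimes>\<^bsub>?Q\<^esub> (I +>\<^bsub>A\<^esub> y) = I +>\<^bsub>A\<^esub> (x \<otimes>\<^bsub>A\<^esub> y)"
    if "x \<in> carrier A" "y \<in> carrier A" for x y
    using add mult that by blast+
  show "k \<odot>\<^bsub>?Q\<^esub> (I +>\<^bsub>A\<^esub> x) = I +>\<^bsub>A\<^esub> (k \<odot>\<^bsub>A\<^esub> x)" if "x \<in> carrier A" for k x
    using smult that .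
qed

lemma monoid_free_monoid: "monoid free_monoid"
  by (rule monoidI) (auto simp: free_monoid_def)

lemma k_algebra_ring: "k_algebra A \<Longrightarrow> ring A"
  by (simp add: k_algebra_def)

lemma ideal_grassmann_ideal:
  "ideal (grassmann_ideal :: (nat list \<Rightarrow>\<^sub>0 'k::field) set) free_algebra"
  unfolding grassmann_ideal_def
  by (rule ring.genideal_ideal[OF k_algebra_ring[OF monoid_algebra_k_algebra[OF monoid_free_monoid]]])
     (auto simp: monoid_algebra_simps free_monoid_def)

lemma k_algebra_grassmann_algebra: "k_algebra grassmann_algebra"
  unfolding grassmann_algebra_def
  by (intro quotient_algebra_k_algebra monoid_algebra_k_algebra monoid_free_monoid
        ideal_grassmann_ideal)

lemma grassmann_monomial_mult:
  "grassmann_monomial v \<otimes>\<^bsub>grassmann_algebra\<^esub> grassmann_monomial w = grassmann_monomial (v @ w)"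
  unfolding grassmann_monomial_def grassmann_algebra_def
  by (subst quotient_algebra_mult[OF monoid_algebra_k_algebra[OF monoid_free_monoid] ideal_grassmann_ideal])
     (simp_all add: monoid_algebra_single_mult monoid_algebra_simps free_monoid_def)

lemma grassmann_monomial_anticommute:
  "grassmann_monomial [i, j] \<oplus>\<^bsub>grassmann_algebra\<^esub> grassmann_monomial [j, i]
     = (\<zero>\<^bsub>grassmann_algebra\<^esub> :: 'k::field grassmann)"
proof -
  have 1: "k_algebra (free_algebra :: ('k, nat list \<Rightarrow>\<^sub>0 'k) module)"
    by (intro monoid_algebra_k_algebra monoid_free_monoid)
  have c: "carrier (free_algebra :: ('k, nat list \<Rightarrow>\<^sub>0 'k) module) = UNIV"
    by (auto simp: monoid_algebra_simps free_monoid_def)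
  have "Poly_Mapping.single [i, j] 1 + Poly_Mapping.single [j, i] 1
          \<in> (grassmann_ideal :: (nat list \<Rightarrow>\<^sub>0 'k) set)"
    unfolding grassmann_ideal_def genideal_def by blast
  then show ?thesis
    unfolding grassmann_monomial_def grassmann_algebra_def
    by (simp add: quotient_algebra_add[OF 1 ideal_grassmann_ideal] c monoid_algebra_simps(4)
          quotient_algebra_zero_iff[OF 1 ideal_grassmann_ideal])
qed

lemma monoid_tensor:
  "k_algebra A \<Longrightarrow> k_algebra B \<Longrightarrow> monoid (A \<times>\<times> B)"
  by (intro DirProd_monoid ring.is_monoid k_algebra_ring)

lemma tensor_relations_subset:
  assumes "k_algebra A" "k_algebra B"
  shows "tensor_relations A B \<subseteq> carrier (monoid_algebra (A \<times>\<times> B))"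
proof -
  interpret A: ring A by (rule k_algebra_ring) fact
  interpret B: ring B by (rule k_algebra_ring) fact
  have "k \<odot>\<^bsub>A\<^esub> x \<in> carrier A" if "x \<in> carrier A" for k x
    using assms(1) that module.smult_closed[of ring_of_type_algebra A k x]
    by (auto simp: k_algebra_def ring_of_type_algebra_def)
  moreover have "k \<odot>\<^bsub>B\<^esub> x \<in> carrier B" if "x \<in> carrier B" for k x
    using assms(2) that module.smult_closed[of ring_of_type_algebra B k x]
    by (auto simp: k_algebra_def ring_of_type_algebra_def)
  ultimately show ?thesis
    unfolding tensor_relations_def monoid_algebra_simps DirProd_def
    by (auto dest!: subsetD[OF keys_diff] split: if_splits)
qed

lemma ideal_tensor_ideal:
  assumes "k_algebra A" "k_algebra B"
  shows "ideal (tensor_ideal A B) (monoid_algebra (A \<times>\<times> B))"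
  unfolding tensor_ideal_def
  by (intro ring.genideal_ideal k_algebra_ring monoid_algebra_k_algebra monoid_tensor
        tensor_relations_subset assms)

lemma k_algebra_tensor_algebra:
  assumes "k_algebra A" "k_algebra B"
  shows "k_algebra (tensor_algebra A B)"
  unfolding tensor_algebra_def
  by (intro quotient_algebra_k_algebra monoid_algebra_k_algebra monoid_tensor ideal_tensor_ideal assms)

lemma pure_tensor_mult:
  assumes "k_algebra A" "k_algebra B" "x \<in> carrier A" "x' \<in> carrier A" "y \<in> carrier B" "y' \<in> carrier B"
  shows "pure_tensor A B x y \<otimes>\<^bsub>tensor_algebra A B\<^esub> pure_tensor A B x' y'
     = pure_tensor A B (x \<otimes>\<^bsub>A\<^esub> x') (y \<otimes>\<^bsub>B\<^esub> y')"
  unfolding pure_tensor_def tensor_algebra_def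
  using assms(3-6)
  by (subst quotient_algebra_mult[OF monoid_algebra_k_algebra[OF monoid_tensor] ideal_tensor_ideal, OF assms(1,2,1,2)])
     (simp_all add: monoid_algebra_single_mult monoid_algebra_simps DirProd_def)

end

theory Submission
  imports Defs
begin

text \<open>
  Let \<open>\<beta>\<close> be the commutation function of \<open>A\<close>. The polynomial \<open>x y - \<beta>(g, h) y x\<close>, with \<open>x\<close> and \<open>y\<close>
  of degrees \<open>g\<close> and \<open>h\<close>, is an identity of \<open>A\<close>, hence of both \<open>E\<close> and \<open>E(C)\<close>. Evaluated at monomials
  \<open>e\<close>, \<open>f\<close> of \<open>E\<close> without common letters it gives \<open>e f = \<beta>(g, h) f e\<close>; evaluated at \<open>c \<otimes> e\<close> and \<open>d \<otimes> f\<close> it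
  gives \<open>c d \<otimes> e f = \<beta>(g, h) d c \<otimes> f e = d c \<otimes> e f\<close>. A linear functional on \<open>E\<close> that does not
  vanish at \<open>e f\<close>, applied to the second tensor factor, turns this into \<open>c d = d c\<close>. The functional
  maps a word to the sign of the permutation that sorts it, and to \<open>0\<close> if a letter is repeated.
  The same functional shows that a monomial in distinct variables is never an identity of \<open>E\<close>, so it
  is not one of \<open>E(C)\<close>; expanding a nonzero value into pure tensors yields homogeneous elements
  of \<open>C\<close> with nonzero product.
\<close>

section \<open>Algebras and linear spans\<close>

abbreviation scalars :: "'k::field ring" where
  "scalars \<equiv> ring_of_type_algebra"

lemma scalars_simps [simp]:
  "carrier scalars = UNIV" "x \<otimes>\<^bsub>scalars\<^esub> y = x * y" "\<one>\<^bsub>scalars\<^esub> = 1"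
  "\<zero>\<^bsub>scalars\<^esub> = 0" "x \<oplus>\<^bsub>scalars\<^esub> y = x + y"
  by (simp_all add: ring_of_type_algebra_def)

locale k_alg =
  fixes A :: "('k::field, 'a) module" (structure)
  assumes k_algebra: "k_algebra A"

sublocale k_alg \<subseteq> ring A
  using k_algebra by (simp add: k_algebra_def)

sublocale k_alg \<subseteq> K: module "scalars :: 'k ring" A
  using k_algebra by (simp add: k_algebra_def)

context k_alg
begin

lemma smult_closed [simp, intro]: "x \<in> carrier A \<Longrightarrow> k \<odot> x \<in> carrier A"
  and smult_add_left: "x \<in> carrier A \<Longrightarrow> (k + l) \<odot> x = k \<odot> x \<oplus> l \<odot> x"
  and smult_add_right: "\<lbrakk>x \<in> carrier A; y \<in> carrier A\<rbrakk> \<Longrightarrow> k \<odot> (x \<oplus> y) = k \<odot> x \<oplus> k \<odot> y"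
  and smult_smult: "x \<in> carrier A \<Longrightarrow> k \<odot> (l \<odot> x) = (k * l) \<odot> x"
  and smult_one [simp]: "x \<in> carrier A \<Longrightarrow> 1 \<odot> x = x"
  and smult_zero_left [simp]: "x \<in> carrier A \<Longrightarrow> 0 \<odot> x = \<zero>"
  and smult_zero_right [simp]: "k \<odot> \<zero> = \<zero>"
  using K.smult_closed[of k x] K.smult_l_distr[of k l x] K.smult_r_distr[of k x y]
    K.smult_assoc1[of k l x] K.smult_one[of x] K.smult_l_null[of x] K.smult_r_null[of k]
  by auto

lemma smult_uminus: "x \<in> carrier A \<Longrightarrow> (- k) \<odot> x = \<ominus> (k \<odot> x)"
  using smult_add_left[of x "- k" k] minus_equality[of "(- k) \<odot> x" "k \<odot> x"] by simp

lemma smult_mult_left: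
  "\<lbrakk>x \<in> carrier A; y \<in> carrier A\<rbrakk> \<Longrightarrow> (k \<odot> x) \<otimes> y = k \<odot> (x \<otimes> y)"
  and smult_mult_right:
  "\<lbrakk>x \<in> carrier A; y \<in> carrier A\<rbrakk> \<Longrightarrow> x \<otimes> (k \<odot> y) = k \<odot> (x \<otimes> y)"
  using k_algebra by (auto simp: k_algebra_def)

lemma subspaceI:
  assumes "H \<subseteq> carrier A" "\<zero> \<in> H"
    and "\<And>x y. x \<in> H \<Longrightarrow> y \<in> H \<Longrightarrow> x \<oplus> y \<in> H"
    and smult: "\<And>k x. x \<in> H \<Longrightarrow> k \<odot> x \<in> H"
  shows "subspace_of H A"
proof (rule K.submoduleI)
  \<comment> \<open>Negation is the scalar \<open>- 1\<close>, so the premises on sums and scalars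
    already yield it.\<close>
  show "\<ominus> x \<in> H" if "x \<in> H" for x
    using smult[OF that, of "- 1"] that assms(1) by (auto simp: smult_uminus subset_iff)
qed (use assms in auto)

lemma subspace_zero: "subspace_of H A \<Longrightarrow> \<zero> \<in> H"
  using subgroup.one_closed[OF submodule.axioms(1)] by force

lemma subspace_smult: "subspace_of H A \<Longrightarrow> x \<in> H \<Longrightarrow> k \<odot> x \<in> H"
  using K.submoduleE(4)[of H k] by simp

lemmas subspace_subset = K.submoduleE(1)
lemmas subspace_add = K.submoduleE(5)

lemma lin_span_subspace:
  assumes "S \<subseteq> carrier A"
  shows "subspace_of (lin_span A S) A"
proof (rule subspaceI)
  show "lin_span A S \<subseteq> carrier A"
    using assms K.carrier_is_submodule unfolding lin_span_def by blast
qed (auto simp: lin_span_def subspace_zero subspace_add subspace_smult)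

lemma lin_span_superset: "S \<subseteq> lin_span A S"
  by (auto simp: lin_span_def)

lemma lin_span_minimal: "subspace_of H A \<Longrightarrow> S \<subseteq> H \<Longrightarrow> lin_span A S \<subseteq> H"
  by (auto simp: lin_span_def)

text \<open>Multiplication is linear in each factor. For fixed \<open>s\<close> in \<open>S\<close>,
  the \<open>y\<close> with \<open>s \<otimes> y\<close> in \<open>U\<close> form a subspace
  containing \<open>T\<close>, hence its span; for a fixed \<open>y\<close> in that span the same
  argument runs in the left factor.\<close>

lemma lin_span_mult:
  assumes S: "S \<subseteq> carrier A" and T: "T \<subseteq> carrier A" and U: "subspace_of U A"
    and ST: "\<And>s t. s \<in> S \<Longrightarrow> t \<in> T \<Longrightarrow> s \<otimes> t \<in> U"
    and x: "x \<in> lin_span A S" and y: "y \<in> lin_span A T"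
  shows "x \<otimes> y \<in> U"
proof -
  have left: "subspace_of {y \<in> carrier A. s \<otimes> y \<in> U} A" if "s \<in> carrier A" for s
    using that subspace_zero[OF U] subspace_add[OF U] subspace_smult[OF U]
    by (intro subspaceI) (auto simp: r_distr smult_mult_right)
  have "lin_span A T \<subseteq> {y \<in> carrier A. s \<otimes> y \<in> U}" if "s \<in> S" for s
    using that S T ST by (intro lin_span_minimal left) auto
  moreover have right: "subspace_of {x \<in> carrier A. x \<otimes> y \<in> U} A" if "y \<in> carrier A" for y
    using that subspace_zero[OF U] subspace_add[OF U] subspace_smult[OF U]
    by (intro subspaceI) (auto simp: l_distr smult_mult_left)
  ultimately have "lin_span A S \<subseteq> {x \<in> carrier A. x \<otimes> y \<in> U}"
    using S y subspace_subset[OF lin_span_subspace[OF T]] by (intro lin_span_minimal right) auto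
  then show ?thesis using x by auto
qed

text \<open>The carrier of the Grassmann envelope is such a sum, which makes it a subspace of the
  tensor product.\<close>

lemma subspace_set_add:
  assumes H: "subspace_of H A" and L: "subspace_of L A"
  shows "subspace_of (H <+>\<^bsub>A\<^esub> L) A"
proof (rule subspaceI)
  note sub = subspace_subset[OF H] subspace_subset[OF L]
  show "(H <+>\<^bsub>A\<^esub> L) \<subseteq> carrier A"
    using sub by (auto simp: set_add_def')
  show "\<zero> \<in> (H <+>\<^bsub>A\<^esub> L)"
    using subspace_zero[OF H] subspace_zero[OF L] by (force simp: set_add_def')
  show "k \<odot> x \<in> (H <+>\<^bsub>A\<^esub> L)" if "x \<in> (H <+>\<^bsub>A\<^esub> L)" for k x
  proof -
    from that obtain a b where "a \<in> H" "b \<in> L" "x = a \<oplus> b"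
      by (auto simp: set_add_def')
    moreover from this have "k \<odot> x = k \<odot> a \<oplus> k \<odot> b"
      using sub by (auto simp: smult_add_right subset_iff)
    ultimately show ?thesis
      using subspace_smult[OF H, of a k] subspace_smult[OF L, of b k] unfolding set_add_def' by blast
  qed
  show "x \<oplus> y \<in> (H <+>\<^bsub>A\<^esub> L)" if "x \<in> (H <+>\<^bsub>A\<^esub> L)" "y \<in> (H <+>\<^bsub>A\<^esub> L)" for x y
  proof -
    from that obtain a b c d where *: "a \<in> H" "b \<in> L" "x = a \<oplus> b" "c \<in> H" "d \<in> L" "y = c \<oplus> d"
      by (auto simp: set_add_def')
    then have "x \<oplus> y = (a \<oplus> c) \<oplus> (b \<oplus> d)"
      using sub by (simp add: subset_iff a_ac)
    then show ?thesis
      using * subspace_add[OF H, of a c] subspace_add[OF L, of b d] unfolding set_add_def' by blast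
  qed
qed

end


lemma quotient_algebra_closed:
  "x \<in> carrier A \<Longrightarrow> I +>\<^bsub>A\<^esub> x \<in> carrier (quotient_algebra A I)"
  by (auto simp: quotient_algebra_def ring.defs FactRing_def A_RCOSETS_def')


section \<open>Linear maps out of a monoid algebra\<close>

lemma monoid_algebra_diff_closed:
  "\<lbrakk>p \<in> carrier (monoid_algebra M); q \<in> carrier (monoid_algebra M)\<rbrakk>
     \<Longrightarrow> p - q \<in> carrier (monoid_algebra M)"
  using keys_diff[of p q] by (auto simp: monoid_algebra_simps)

lemma monoid_algebra_diff_mult:
  fixes p q r :: "'m \<Rightarrow>\<^sub>0 'k::field"
  shows "(p - q) \<otimes>\<^bsub>monoid_algebra M\<^esub> r
     = p \<otimes>\<^bsub>monoid_algebra M\<^esub> r - q \<otimes>\<^bsub>monoid_algebra M\<^esub> r"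
    and "r \<otimes>\<^bsub>monoid_algebra M\<^esub> (p - q)
     = r \<otimes>\<^bsub>monoid_algebra M\<^esub> p - r \<otimes>\<^bsub>monoid_algebra M\<^esub> q"
  using monoid_algebra_distrib_right[where p = "p - q" and q = q and r = r and M = M]
    monoid_algebra_distrib_left[where p = "p - q" and q = q and r = r and M = M]
  by simp_all

lemma monoid_algebra_induct [consumes 1, case_names zero single add]:
  fixes p :: "'m \<Rightarrow>\<^sub>0 'k::field"
  assumes "p \<in> carrier (monoid_algebra M)"
    and zero: "P 0" and single: "\<And>w c. w \<in> carrier M \<Longrightarrow> P (Poly_Mapping.single w c)"
    and add: "\<And>p q. \<lbrakk>p \<in> carrier (monoid_algebra M); q \<in> carrier (monoid_algebra M); P p; P q\<rbrakk>
      \<Longrightarrow> P (p + q)"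
  shows "P p"
proof -
  let ?C = "carrier (monoid_algebra M :: ('k, _) module)"
  \<comment> \<open>The induction runs over finite sets of basis elements, with coefficients taken
    from the fixed \<open>p\<close>. Membership in the carrier is carried along because the rule
    \<open>add\<close> asks for it.\<close>
  have "sum (\<lambda>w. Poly_Mapping.single w (Poly_Mapping.lookup p w)) S \<in> ?C
      \<and> P (sum (\<lambda>w. Poly_Mapping.single w (Poly_Mapping.lookup p w)) S)"
    if "finite S" "S \<subseteq> carrier M" for S
    using that
  proof (induction S)
    case empty
    then show ?case using zero by (simp add: monoid_algebra_simps)
  next
    case (insert w S)
    moreover have "Poly_Mapping.single w (Poly_Mapping.lookup p w) \<in> ?C"
      using insert by (auto simp: monoid_algebra_simps)
    moreover have "a + b \<in> ?C" if "a \<in> ?C" "b \<in> ?C" for a b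
      using that keys_add[of a b] by (auto simp: monoid_algebra_simps)
    ultimately show ?case using single add by auto
  qed
  then show ?thesis
    using assms(1) poly_mapping_eq_sum_single[of p] by (metis finite_keys mem_Collect_eq monoid_algebra_simps(1))
qed

text \<open>Only linearity is intended: neither the sign functional nor the contraction of a tensor
  factor by it is multiplicative.\<close>

definition linear_extension ::
    "('k::field, 'a) module \<Rightarrow> ('m \<Rightarrow> 'a) \<Rightarrow> ('m \<Rightarrow>\<^sub>0 'k) \<Rightarrow> 'a" where
  "linear_extension A F p = (\<Oplus>\<^bsub>A\<^esub>w\<in>Poly_Mapping.keys p. Poly_Mapping.lookup p w \<odot>\<^bsub>A\<^esub> F w)"

locale monoid_algebra_map = k_alg A + M: monoid M
  for A :: "('k::field, 'a) module" (structure) and M :: "('m, 'r) monoid_scheme" +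
  fixes F :: "'m \<Rightarrow> 'a"
  assumes F_closed: "w \<in> carrier M \<Longrightarrow> F w \<in> carrier A"
begin

abbreviation "KM \<equiv> monoid_algebra M :: ('k, 'm \<Rightarrow>\<^sub>0 'k) module"
abbreviation "L \<equiv> linear_extension A F"

sublocale KM: k_alg KM
  by unfold_locales (intro monoid_algebra_k_algebra M.monoid_axioms)

text \<open>Coefficients off the support are zero. A common index set is needed for sums, whose
  support can shrink by cancellation.\<close>

lemma linear_extension_superset:
  assumes "finite S" "Poly_Mapping.keys p \<subseteq> S" "S \<subseteq> carrier M"
  shows "L p = (\<Oplus>w\<in>S. Poly_Mapping.lookup p w \<odot> F w)"
  unfolding linear_extension_def
  by (rule add.finprod_mono_neutral_cong_left) (use assms F_closed in \<open>auto simp: in_keys_iff subset_iff\<close>)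

lemma linear_extension_closed: "p \<in> carrier KM \<Longrightarrow> L p \<in> carrier A"
  unfolding linear_extension_def
  by (rule finsum_closed) (auto simp: monoid_algebra_simps F_closed subset_iff)

lemma linear_extension_single: "w \<in> carrier M \<Longrightarrow> L (Poly_Mapping.single w c) = c \<odot> F w"
  by (subst linear_extension_superset[of "{w}"]) (auto simp: F_closed)

lemma linear_extension_zero: "L 0 = \<zero>"
  by (simp add: linear_extension_def)

lemma linear_extension_add:
  assumes "p \<in> carrier KM" "q \<in> carrier KM"
  shows "L (p + q) = L p \<oplus> L q"
proof -
  let ?S = "Poly_Mapping.keys p \<union> Poly_Mapping.keys q"
  have S: "?S \<subseteq> carrier M" using assms by (auto simp: monoid_algebra_simps)
  then have "(\<lambda>w. Poly_Mapping.lookup r w \<odot> F w) \<in> ?S \<rightarrow> carrier A" for r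
    using F_closed by auto
  moreover have "(\<Oplus>w\<in>?S. Poly_Mapping.lookup (p + q) w \<odot> F w)
      = (\<Oplus>w\<in>?S. Poly_Mapping.lookup p w \<odot> F w \<oplus> Poly_Mapping.lookup q w \<odot> F w)"
    using S by (intro finsum_cong') (auto simp: lookup_add smult_add_left F_closed subset_iff)
  ultimately show ?thesis
    using S keys_add[of p q] by (simp add: linear_extension_superset[of ?S] finsum_addf)
qed

lemma linear_extension_diff:
  assumes "p \<in> carrier KM" "q \<in> carrier KM"
  shows "L (p - q) = L p \<ominus> L q"
proof -
  have "p - q \<in> carrier KM"
    using assms by (rule monoid_algebra_diff_closed)
  then have "L p = L (p - q) \<oplus> L q"
    using linear_extension_add[of "p - q" q] assms by simp
  then show ?thesis
    using assms \<open>p - q \<in> carrier KM\<close> linear_extension_closed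
    by (simp add: minus_eq add.m_assoc r_neg)
qed

lemma linear_extension_smult:
  assumes "p \<in> carrier KM"
  shows "L (Poly_Mapping.map (\<lambda>c. k * c) p) = k \<odot> L p"
  using assms
proof (induction p rule: monoid_algebra_induct)
  case zero
  then show ?case
    using KM.smult_zero_right[of k] by (simp add: monoid_algebra_simps(2,5) linear_extension_zero)
next
  case (single w c)
  then show ?case by (simp add: linear_extension_single smult_smult F_closed)
next
  case (add p q)
  have "Poly_Mapping.map (\<lambda>c. k * c) r \<in> carrier KM" if "r \<in> carrier KM" for r
    using KM.smult_closed[OF that, of k] by (simp add: monoid_algebra_simps(5))
  moreover have "Poly_Mapping.map (\<lambda>c. k * c) (p + q)
      = Poly_Mapping.map (\<lambda>c. k * c) p + Poly_Mapping.map (\<lambda>c. k * c) q"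
    using KM.smult_add_right[OF add(1,2), of k] by (simp add: monoid_algebra_simps(4,5))
  ultimately show ?case
    using add by (simp add: linear_extension_add linear_extension_closed smult_add_right)
qed

text \<open>The kernel of a linear map need not be an ideal, but the \<open>p\<close> for which
  \<open>L\<close> kills every product \<open>a p b\<close> do form one. Linearity in
  \<open>a\<close> and \<open>b\<close> reduces the test on generators to single terms, and
  \<open>a = b = 1\<close> shows that this ideal lies in the kernel.\<close>

lemma linear_extension_genideal:
  assumes R: "R \<subseteq> carrier KM"
    and vanish: "\<And>r u v c d. \<lbrakk>r \<in> R; u \<in> carrier M; v \<in> carrier M\<rbrakk> \<Longrightarrow>
      L (Poly_Mapping.single u c \<otimes>\<^bsub>KM\<^esub> r \<otimes>\<^bsub>KM\<^esub> Poly_Mapping.single v d) = \<zero>"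
    and p: "p \<in> genideal KM R"
  shows "L p = \<zero>"
proof -
  have add: "x \<oplus>\<^bsub>KM\<^esub> y = x + y" and zero: "\<zero>\<^bsub>KM\<^esub> = 0" for x y :: "'m \<Rightarrow>\<^sub>0 'k"
    by (simp_all add: monoid_algebra_simps)
  have single: "Poly_Mapping.single u c \<in> carrier KM" if "u \<in> carrier M" for u and c :: 'k
    using that by (auto simp: monoid_algebra_simps)
  let ?J = "{p \<in> carrier KM. \<forall>a\<in>carrier KM. \<forall>b\<in>carrier KM. L (a \<otimes>\<^bsub>KM\<^esub> p \<otimes>\<^bsub>KM\<^esub> b) = \<zero>}"
  have "ideal ?J KM"
  proof (rule idealI)
    show "ring KM" by (rule KM.ring_axioms)
    have "subspace_of ?J KM"
    proof (rule KM.subspaceI, goal_cases)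
      case 2
      then show ?case
        using KM.zero_closed by (simp add: linear_extension_zero zero monoid_algebra_zero_mult)
    next
      case (3 x y)
      then show ?case
        by (auto simp: KM.r_distr KM.l_distr)
           (simp add: linear_extension_add add)
    next
      case (4 k x)
      \<comment> \<open>The scalar moves into the left factor, which is arbitrary anyway.\<close>
      have "a \<otimes>\<^bsub>KM\<^esub> (k \<odot>\<^bsub>KM\<^esub> x) \<otimes>\<^bsub>KM\<^esub> b = (k \<odot>\<^bsub>KM\<^esub> a) \<otimes>\<^bsub>KM\<^esub> x \<otimes>\<^bsub>KM\<^esub> b"
        if "a \<in> carrier KM" "b \<in> carrier KM" for a b
        using that 4 by (simp add: KM.smult_mult_left KM.smult_mult_right)
      then show ?case using 4 by simp
    qed auto
    then show "subgroup ?J (add_monoid KM)" by (rule submodule.axioms(1))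
    show "x \<otimes>\<^bsub>KM\<^esub> a \<in> ?J" if "a \<in> ?J" "x \<in> carrier KM" for a x
    proof -
      have "b \<otimes>\<^bsub>KM\<^esub> (x \<otimes>\<^bsub>KM\<^esub> a) = (b \<otimes>\<^bsub>KM\<^esub> x) \<otimes>\<^bsub>KM\<^esub> a" if "b \<in> carrier KM" for b
        using \<open>a \<in> ?J\<close> \<open>x \<in> carrier KM\<close> that by (simp add: KM.m_assoc)
      then show ?thesis using that by simp
    qed
    show "a \<otimes>\<^bsub>KM\<^esub> x \<in> ?J" if "a \<in> ?J" "x \<in> carrier KM" for a x
    proof -
      have "b \<otimes>\<^bsub>KM\<^esub> (a \<otimes>\<^bsub>KM\<^esub> x) \<otimes>\<^bsub>KM\<^esub> c = b \<otimes>\<^bsub>KM\<^esub> a \<otimes>\<^bsub>KM\<^esub> (x \<otimes>\<^bsub>KM\<^esub> c)"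
        if "b \<in> carrier KM" "c \<in> carrier KM" for b c
        using \<open>a \<in> ?J\<close> \<open>x \<in> carrier KM\<close> that by (simp add: KM.m_assoc)
      then show ?thesis using that by simp
    qed
  qed
  moreover have "L (a \<otimes>\<^bsub>KM\<^esub> r \<otimes>\<^bsub>KM\<^esub> b) = \<zero>"
    if r: "r \<in> R" and a: "a \<in> carrier KM" and b: "b \<in> carrier KM" for r a b
  proof -
    have rc: "r \<in> carrier KM" using r R by auto
    \<comment> \<open>The right factor is made arbitrary first, while the left one is still a single
      term; the left factor follows.\<close>
    have "L (Poly_Mapping.single u c \<otimes>\<^bsub>KM\<^esub> r \<otimes>\<^bsub>KM\<^esub> b) = \<zero>" if u: "u \<in> carrier M" for u c
      using b
    proof (induction b rule: monoid_algebra_induct)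
      case zero
      then show ?case by (simp add: monoid_algebra_zero_mult linear_extension_zero)
    next
      case (single v d)
      then show ?case using vanish r u by simp
    next
      case (add p q)
      then show ?case
        using single[OF u] rc by (simp add: monoid_algebra_distrib_left linear_extension_add)
    qed
    note single = this
    show ?thesis using a
    proof (induction a rule: monoid_algebra_induct)
      case zero
      then show ?case by (simp add: monoid_algebra_zero_mult linear_extension_zero)
    next
      case (add p q)
      then show ?case
        using b rc by (simp add: monoid_algebra_distrib_right linear_extension_add)
    qed (rule single)
  qed
  ultimately have "genideal KM R \<subseteq> ?J"
    using R by (intro KM.genideal_minimal) auto
  with p have pJ: "p \<in> ?J" by auto
  then have "L (\<one>\<^bsub>KM\<^esub> \<otimes>\<^bsub>KM\<^esub> p \<otimes>\<^bsub>KM\<^esub> \<one>\<^bsub>KM\<^esub>) = \<zero>"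
    using KM.one_closed by blast
  then show ?thesis using pJ by simp
qed

end


section \<open>The sign functional on the Grassmann algebra\<close>

text \<open>The field as an algebra over itself, so that linear functionals are instances of
  \<open>linear_extension\<close>.\<close>

definition scalar_algebra :: "('k::field, 'k) module" where
  "scalar_algebra = ring.extend scalars \<lparr>module.smult = (*)\<rparr>"

lemma scalar_algebra_simps [simp]:
  "carrier scalar_algebra = UNIV" "x \<otimes>\<^bsub>scalar_algebra\<^esub> y = x * y" "\<one>\<^bsub>scalar_algebra\<^esub> = 1"
  "\<zero>\<^bsub>scalar_algebra\<^esub> = 0" "x \<oplus>\<^bsub>scalar_algebra\<^esub> y = x + y" "k \<odot>\<^bsub>scalar_algebra\<^esub> x = k * x"
  by (simp_all add: scalar_algebra_def ring.defs ring_of_type_algebra_def)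

lemma k_algebra_scalar_algebra: "k_algebra scalar_algebra"
proof -
  have ab: "abelian_group scalar_algebra"
    by (rule abelian_groupI) (auto simp: ac_simps intro: exI[of _ "- x" for x])
  moreover have "monoid scalar_algebra"
    by (rule monoidI) (auto simp: ac_simps)
  ultimately have "ring scalar_algebra"
    by (rule ringI) (auto simp: algebra_simps)
  moreover have "module scalars scalar_algebra"
    by (rule moduleI[OF cring_from_type_algebra ab]) (auto simp: algebra_simps)
  ultimately show ?thesis
    by (auto simp: k_algebra_def)
qed

text \<open>For distinct letters this is \<open>- 1\<close> to the number of inversions; each
  recursion step counts the inversions that involve the first letter.\<close>

fun word_sign :: "nat list \<Rightarrow> 'k::field" where
  "word_sign [] = 1"
| "word_sign (i # w) =
     (if i \<in> set w then 0 else (- 1) ^ length (filter (\<lambda>j. j < i) w) * word_sign w)"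

text \<open>Swapping adjacent distinct letters changes the number of inversions by one. If
  \<open>i = j\<close>, both signs are zero because a letter is repeated, so the argument holds in
  every characteristic.\<close>

lemma word_sign_swap:
  "word_sign (u @ i # j # v) + word_sign (u @ j # i # v) = (0 :: 'k::field)"
proof (induction u)
  case Nil
  then show ?case by (cases i j rule: linorder_cases) auto
next
  case (Cons k u)
  \<comment> \<open>A letter in front of the swapped pair sees the same later letters in both words,
    so both signs acquire the same factor.\<close>
  have "length (filter (\<lambda>l. l < k) (u @ i # j # v)) = length (filter (\<lambda>l. l < k) (u @ j # i # v))"
    by simp
  then show ?case using Cons by (auto simp flip: distrib_left)
qed

lemma word_sign_nonzero: "distinct w \<Longrightarrow> word_sign w \<noteq> 0"
  by (induction w) auto

interpretation word_sign: monoid_algebra_map scalar_algebra free_monoid word_sign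
  by (intro monoid_algebra_map.intro k_alg.intro monoid_algebra_map_axioms.intro
      k_algebra_scalar_algebra monoid_free_monoid) simp

abbreviation sign_extension :: "(nat list \<Rightarrow>\<^sub>0 'k::field) \<Rightarrow> 'k" where
  "sign_extension \<equiv> linear_extension scalar_algebra word_sign"

lemma carrier_free_algebra: "carrier free_algebra = UNIV"
  by (auto simp: monoid_algebra_simps free_monoid_def)

lemma free_monoid_simps: "carrier free_monoid = UNIV" "u \<otimes>\<^bsub>free_monoid\<^esub> v = u @ v"
  by (auto simp: free_monoid_def)

text \<open>Multiplying a generator of the ideal by words \<open>u\<close> and \<open>v\<close>
  gives two words that differ by an adjacent swap, and their signs cancel.\<close>

lemma sign_extension_grassmann_ideal:
  assumes "p \<in> grassmann_ideal"
  shows "sign_extension p = (0 :: 'k::field)"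
proof -
  have "sign_extension p = \<zero>\<^bsub>scalar_algebra\<^esub>"
  proof (rule word_sign.linear_extension_genideal[OF _ _ assms[unfolded grassmann_ideal_def]], goal_cases)
    case 1 then show ?case by (simp add: carrier_free_algebra)
  next
    case (2 r u v c d)
    then obtain i j where "r = Poly_Mapping.single [i, j] 1 + Poly_Mapping.single [j, i] 1"
      by auto
    then show ?case
      using word_sign_swap[of u i j v, where 'k = 'k]
      by (simp add: monoid_algebra_distrib_left monoid_algebra_distrib_right
          monoid_algebra_single_mult free_monoid_simps word_sign.linear_extension_add
          carrier_free_algebra word_sign.linear_extension_single flip: distrib_left)
  qed
  then show ?thesis by simp
qed

text \<open>Elements of the Grassmann algebra are cosets. The chosen representative does not matter,
  since \<open>sign_extension\<close> vanishes on the ideal.\<close>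

definition grassmann_sign :: "'k::field grassmann \<Rightarrow> 'k" where
  "grassmann_sign S = sign_extension (SOME p. p \<in> S)"

lemma grassmann_sign_coset:
  "grassmann_sign (grassmann_ideal +>\<^bsub>free_algebra\<^esub> p) = sign_extension p"
proof -
  let ?S = "grassmann_ideal +>\<^bsub>free_algebra\<^esub> p"
  have "sign_extension q = sign_extension p" if "q \<in> ?S" for q
  proof -
    from that obtain i where "i \<in> grassmann_ideal" "q = i + p"
      by (auto simp: a_r_coset_def r_coset_def monoid_algebra_simps)
    then show ?thesis
      by (simp add: word_sign.linear_extension_add carrier_free_algebra
          sign_extension_grassmann_ideal)
  qed
  moreover have "p \<in> ?S"
    using additive_subgroup.zero_closed[OF ideal.axioms(1)[OF ideal_grassmann_ideal]]
    by (force simp: a_r_coset_def r_coset_def monoid_algebra_simps)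
  ultimately show ?thesis
    unfolding grassmann_sign_def by (metis someI_ex)
qed

lemma grassmann_sign_monomial: "grassmann_sign (grassmann_monomial w) = word_sign w"
  by (simp add: grassmann_monomial_def grassmann_sign_coset word_sign.linear_extension_single
      free_monoid_simps)

interpretation grassmann: k_alg grassmann_algebra
  by (rule k_alg.intro) (rule k_algebra_grassmann_algebra)


lemma grassmann_cosetE:
  assumes "x \<in> carrier grassmann_algebra"
  obtains p where "x = grassmann_ideal +>\<^bsub>free_algebra\<^esub> p"
proof -
  have "\<exists>p. x = grassmann_ideal +>\<^bsub>free_algebra\<^esub> p"
    using assms
    by (auto simp: grassmann_algebra_def quotient_algebra_def ring.defs FactRing_def A_RCOSETS_def')
  then show ?thesis using that by (elim exE)
qed

lemma grassmann_sign_add: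
  assumes "x \<in> carrier grassmann_algebra" "y \<in> carrier grassmann_algebra"
  shows "grassmann_sign (x \<oplus>\<^bsub>grassmann_algebra\<^esub> y) = grassmann_sign x + grassmann_sign y"
proof -
  obtain p q where "x = grassmann_ideal +>\<^bsub>free_algebra\<^esub> p" "y = grassmann_ideal +>\<^bsub>free_algebra\<^esub> q"
    by (rule grassmann_cosetE[OF assms(1)], rule grassmann_cosetE[OF assms(2)])
  then show ?thesis
    by (simp add: grassmann_algebra_def
        quotient_algebra_add[OF word_sign.KM.k_algebra ideal_grassmann_ideal] carrier_free_algebra
        grassmann_sign_coset monoid_algebra_simps(4) word_sign.linear_extension_add)
qed

lemma grassmann_sign_smult:
  assumes "x \<in> carrier grassmann_algebra"
  shows "grassmann_sign (k \<odot>\<^bsub>grassmann_algebra\<^esub> x) = k * grassmann_sign x"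
proof -
  obtain p where "x = grassmann_ideal +>\<^bsub>free_algebra\<^esub> p"
    by (rule grassmann_cosetE[OF assms])
  then show ?thesis
    by (simp add: grassmann_algebra_def
        quotient_algebra_smult[OF word_sign.KM.k_algebra ideal_grassmann_ideal] carrier_free_algebra
        grassmann_sign_coset monoid_algebra_simps(5) word_sign.linear_extension_smult)
qed

lemma grassmann_monomial_closed: "grassmann_monomial w \<in> carrier grassmann_algebra"
  unfolding grassmann_monomial_def grassmann_algebra_def
  by (rule quotient_algebra_closed) (simp add: carrier_free_algebra)

lemma grassmann_monomial_Nil: "grassmann_monomial [] = \<one>\<^bsub>grassmann_algebra\<^esub>"
  by (simp add: grassmann_monomial_def grassmann_algebra_def quotient_algebra_def ring.defs
      FactRing_def monoid_algebra_simps free_monoid_def)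

lemma grassmann_component_subspace: "subspace_of (grassmann_component g) grassmann_algebra"
  unfolding grassmann_component_def
  by (rule grassmann.lin_span_subspace) (auto simp: grassmann_monomial_closed)

lemma grassmann_monomial_in_component:
  "of_nat (length w) = g \<Longrightarrow> grassmann_monomial w \<in> grassmann_component g"
  unfolding grassmann_component_def by (rule subsetD[OF grassmann.lin_span_superset]) auto

lemma list_prod_grassmann_monomial:
  "list_prod grassmann_algebra (map (\<lambda>x. grassmann_monomial (f x)) xs)
     = grassmann_monomial (concat (map f xs))"
  by (induction xs) (auto simp: list_prod_def grassmann_monomial_Nil grassmann_monomial_mult)


section \<open>Tensor products\<close>

lemma single_tensor_closed:
  "\<lbrakk>x \<in> carrier A; y \<in> carrier B\<rbrakk> \<Longrightarrow>
     Poly_Mapping.single (x, y) c \<in> carrier (monoid_algebra (A \<times>\<times> B))"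
  by (auto simp: monoid_algebra_simps DirProd_def)

text \<open>A linear functional \<open>f\<close> on \<open>B\<close> induces the linear map from the
  tensor product to \<open>A\<close> that sends \<open>x \<otimes> y\<close> to
  \<open>f(y) x\<close>. The locale builds it on the monoid algebra, before passing to the
  quotient.\<close>

locale tensor_contraction = A: k_alg A + B: k_alg B
  for A :: "('k::field, 'a) module" and B :: "('k, 'b) module" +
  fixes f :: "'b \<Rightarrow> 'k"
  assumes f_add: "\<lbrakk>x \<in> carrier B; y \<in> carrier B\<rbrakk> \<Longrightarrow> f (x \<oplus>\<^bsub>B\<^esub> y) = f x + f y"
    and f_smult: "x \<in> carrier B \<Longrightarrow> f (k \<odot>\<^bsub>B\<^esub> x) = k * f x"
begin

sublocale contr: monoid_algebra_map A "A \<times>\<times> B" "\<lambda>(x, y). f y \<odot>\<^bsub>A\<^esub> x"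
  by (intro monoid_algebra_map.intro A.k_alg_axioms monoid_tensor A.k_algebra B.k_algebra
      monoid_algebra_map_axioms.intro) auto

text \<open>A bilinearity relation multiplied by basis pairs on both sides is, up to a scalar, again
  a bilinearity relation. So it is enough that \<open>f(y) x\<close> is bilinear in \<open>x\<close>
  and \<open>y\<close>; \<open>f\<close> need not be multiplicative.\<close>

lemma contraction_tensor_ideal:
  assumes "p \<in> tensor_ideal A B"
  shows "contr.L p = \<zero>\<^bsub>A\<^esub>"
proof (rule contr.linear_extension_genideal[OF _ _ assms[unfolded tensor_ideal_def]])
  show "tensor_relations A B \<subseteq> carrier contr.KM"
    by (rule tensor_relations_subset) (rule A.k_algebra B.k_algebra)+
next
  fix r u v c d
  assume r: "r \<in> tensor_relations A B" and u: "u \<in> carrier (A \<times>\<times> B)" and v: "v \<in> carrier (A \<times>\<times> B)"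
  obtain u1 u2 v1 v2 where uv: "u = (u1, u2)" "v = (v1, v2)" "u1 \<in> carrier A" "v1 \<in> carrier A"
    "u2 \<in> carrier B" "v2 \<in> carrier B"
    using u v by (auto simp: DirProd_def)
  \<comment> \<open>The two additivity relations contract to the first form, the two scalar
    relations to the second.\<close>
  have cancel: "a \<oplus>\<^bsub>A\<^esub> b \<ominus>\<^bsub>A\<^esub> a \<ominus>\<^bsub>A\<^esub> b = \<zero>\<^bsub>A\<^esub>" "a \<ominus>\<^bsub>A\<^esub> a = \<zero>\<^bsub>A\<^esub>"
    if "a \<in> carrier A" "b \<in> carrier A" for a b
    using that A.r_neg[of "a \<oplus>\<^bsub>A\<^esub> b"]
    by (simp_all add: A.minus_eq A.r_neg A.a_assoc A.minus_add)
  note * = monoid_algebra_diff_mult monoid_algebra_single_mult contr.linear_extension_diff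
    contr.linear_extension_single single_tensor_closed monoid_algebra_diff_closed uv
    A.l_distr A.r_distr B.l_distr B.r_distr A.smult_mult_left A.smult_mult_right
    B.smult_mult_left B.smult_mult_right f_add f_smult A.smult_smult A.smult_add_left
    A.smult_add_right cancel mult_ac
  show "contr.L (Poly_Mapping.single u c \<otimes>\<^bsub>contr.KM\<^esub> r \<otimes>\<^bsub>contr.KM\<^esub> Poly_Mapping.single v d) = \<zero>\<^bsub>A\<^esub>"
    using r unfolding tensor_relations_def
    by (elim UnE CollectE exE conjE) (simp_all add: *)
qed

text \<open>This brings an equation between tensors back to \<open>A\<close>: its representative
  lies in the tensor ideal, which the contraction kills.\<close>

lemma pure_tensor_cancel:
  assumes "x \<in> carrier A" "x' \<in> carrier A" "y \<in> carrier B" "y' \<in> carrier B"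
    and eq: "pure_tensor A B x y \<oplus>\<^bsub>tensor_algebra A B\<^esub> k \<odot>\<^bsub>tensor_algebra A B\<^esub> pure_tensor A B x' y'
      = \<zero>\<^bsub>tensor_algebra A B\<^esub>"
  shows "f y \<odot>\<^bsub>A\<^esub> x \<oplus>\<^bsub>A\<^esub> (k * f y') \<odot>\<^bsub>A\<^esub> x' = \<zero>\<^bsub>A\<^esub>"
proof -
  note id = contr.KM.k_algebra ideal_tensor_ideal[OF A.k_algebra B.k_algebra]
  have c: "Poly_Mapping.single (x, y) l \<in> carrier contr.KM"
    "Poly_Mapping.single (x', y') l \<in> carrier contr.KM" for l
    using assms by (auto simp: monoid_algebra_simps)
  have "contr.L (Poly_Mapping.single (x, y) 1 + Poly_Mapping.single (x', y') k) = \<zero>\<^bsub>A\<^esub>"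
    using eq c contr.KM.a_closed[OF c]
    by (intro contraction_tensor_ideal)
       (simp add: pure_tensor_def tensor_algebra_def quotient_algebra_add[OF id]
         quotient_algebra_smult[OF id] quotient_algebra_zero_iff[OF id] monoid_algebra_simps(4,5))
  then show ?thesis
    using assms c by (simp add: contr.linear_extension_add contr.linear_extension_single A.smult_smult)
qed

end

lemma pure_tensor_closed:
  "\<lbrakk>x \<in> carrier A; y \<in> carrier B\<rbrakk> \<Longrightarrow> pure_tensor A B x y \<in> carrier (tensor_algebra A B)"
  unfolding pure_tensor_def tensor_algebra_def
  by (intro quotient_algebra_closed single_tensor_closed)

lemma pure_tensor_one:
  "pure_tensor A B \<one>\<^bsub>A\<^esub> \<one>\<^bsub>B\<^esub> = \<one>\<^bsub>tensor_algebra A B\<^esub>"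
  by (simp add: pure_tensor_def tensor_algebra_def quotient_algebra_def ring.defs FactRing_def
      monoid_algebra_simps DirProd_def)

lemma pure_tensor_zero:
  assumes A: "k_algebra A" and B: "k_algebra B" and y: "y \<in> carrier B"
  shows "pure_tensor A B \<zero>\<^bsub>A\<^esub> y = \<zero>\<^bsub>tensor_algebra A B\<^esub>"
proof -
  interpret A: k_alg A by (rule k_alg.intro) fact
  note alg = monoid_algebra_k_algebra[OF monoid_tensor[OF A B]]
  \<comment> \<open>The scalar relation for \<open>k = 0\<close>: its second term has coefficient
    zero, so the basis element itself is a relation.\<close>
  have "Poly_Mapping.single (0 \<odot>\<^bsub>A\<^esub> \<zero>\<^bsub>A\<^esub>, y) 1 - Poly_Mapping.single (\<zero>\<^bsub>A\<^esub>, y) 0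
      \<in> tensor_relations A B"
    unfolding tensor_relations_def using A.zero_closed y by blast
  then have "Poly_Mapping.single (\<zero>\<^bsub>A\<^esub>, y) 1 \<in> tensor_ideal A B"
    using ring.genideal_self[OF k_algebra_ring[OF alg] tensor_relations_subset[OF A B]]
    by (auto simp: tensor_ideal_def)
  then show ?thesis
    unfolding pure_tensor_def tensor_algebra_def
    by (subst quotient_algebra_zero_iff[OF alg ideal_tensor_ideal[OF A B]])
       (use y in \<open>auto intro: single_tensor_closed\<close>)
qed


section \<open>The Grassmann envelope\<close>

locale graded_alg = k_alg C for C :: "('k::field, 'c) module" (structure) +
  fixes G :: "bit \<Rightarrow> 'c set"
  assumes graded: "graded_algebra C G"
begin

abbreviation "T \<equiv> tensor_algebra C grassmann_algebra"
abbreviation "Env \<equiv> grassmann_envelope C G"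
abbreviation "pure \<equiv> pure_tensor C grassmann_algebra"

sublocale T: k_alg T
  by (intro k_alg.intro k_algebra_tensor_algebra k_algebra k_algebra_grassmann_algebra)

lemma component_subspace: "subspace_of (G g) C"
  and component_mult: "\<lbrakk>x \<in> G g; y \<in> G h\<rbrakk> \<Longrightarrow> x \<otimes> y \<in> G (g + h)"
  and decomposition: "x \<in> carrier C \<Longrightarrow> \<exists>x0\<in>G 0. \<exists>x1\<in>G 1. x = x0 \<oplus> x1"
  using graded unfolding graded_algebra_def by blast+

lemma component_closed: "x \<in> G g \<Longrightarrow> x \<in> carrier C"
  using subspace_subset[OF component_subspace] by auto

lemmas grassmann_component_closed =
  subsetD[OF grassmann.subspace_subset[OF grassmann_component_subspace]]

lemma pure_closed: "\<lbrakk>x \<in> carrier C; y \<in> carrier grassmann_algebra\<rbrakk> \<Longrightarrow> pure x y \<in> carrier T"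
  by (rule pure_tensor_closed)

lemma envelope_generators:
  "{pure x y | x y. x \<in> G g \<and> y \<in> grassmann_component g} \<subseteq> carrier T"
  by (auto intro!: pure_closed component_closed grassmann_component_closed)

lemma envelope_component_subspace: "subspace_of (envelope_component C G g) T"
  unfolding envelope_component_def by (rule T.lin_span_subspace) (rule envelope_generators)

lemma pure_in_envelope_component:
  "\<lbrakk>x \<in> G g; y \<in> grassmann_component g\<rbrakk> \<Longrightarrow> pure x y \<in> envelope_component C G g"
  unfolding envelope_component_def by (rule subsetD[OF T.lin_span_superset]) auto

lemma envelope_simps:
  "\<zero>\<^bsub>Env\<^esub> = \<zero>\<^bsub>T\<^esub>" "x \<oplus>\<^bsub>Env\<^esub> y = x \<oplus>\<^bsub>T\<^esub> y" "k \<odot>\<^bsub>Env\<^esub> x = k \<odot>\<^bsub>T\<^esub> x"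
  "list_prod Env xs = list_prod T xs"
  by (simp_all add: grassmann_envelope_def list_prod_def)

lemma carrier_envelope_subspace: "subspace_of (carrier Env) T"
  unfolding grassmann_envelope_def
  using T.subspace_set_add[OF envelope_component_subspace envelope_component_subspace] by simp

text \<open>Evaluating a polynomial in the envelope is a finite sum there, and this is the structure
  such sums require. It is inherited from \<open>T\<close> by a submodule.\<close>

lemma abelian_monoid_envelope: "abelian_monoid Env"
proof -
  have "module scalars (T\<lparr>carrier := carrier Env\<rparr>)"
    by (rule submodule.submodule_is_module[OF carrier_envelope_subspace T.K.module_axioms])
  moreover have "T\<lparr>carrier := carrier Env\<rparr> = Env"
    by (simp add: grassmann_envelope_def)
  ultimately show ?thesis
    by (metis module_def abelian_group_def)
qed

lemma envelope_component_subset: "envelope_component C G g \<subseteq> carrier Env"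
proof
  fix x assume x: "x \<in> envelope_component C G g"
  then have "x \<in> carrier T"
    using T.subspace_subset[OF envelope_component_subspace] by blast
  then have "x = x \<oplus>\<^bsub>T\<^esub> \<zero>\<^bsub>T\<^esub>" "x = \<zero>\<^bsub>T\<^esub> \<oplus>\<^bsub>T\<^esub> x" by simp_all
  moreover have "\<zero>\<^bsub>T\<^esub> \<in> envelope_component C G h" for h
    by (rule T.subspace_zero[OF envelope_component_subspace])
  ultimately show "x \<in> carrier Env"
    using x unfolding grassmann_envelope_def set_add_def' by (cases g) (simp_all, metis+)
qed

text \<open>Expanding every factor into pure tensors leaves products of homogeneous elements of
  \<open>C\<close> in the first tensor slot. The second slot is recorded only as some element of the
  Grassmann algebra, because the conclusion drawn later concerns \<open>C\<close>.\<close>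

lemma envelope_list_prod:
  assumes "list_all2 (\<lambda>g a. a \<in> envelope_component C G g) gs as"
  shows "list_prod T as \<in> lin_span T {pure (list_prod C cs) y | cs y.
    list_all2 (\<lambda>g c. c \<in> G g) gs cs \<and> y \<in> carrier grassmann_algebra}"
    (is "_ \<in> lin_span T (?S gs)")
  using assms
proof (induction rule: list_all2_induct)
  case Nil
  have "pure (list_prod C []) \<one>\<^bsub>grassmann_algebra\<^esub> \<in> ?S []" by blast
  then show ?case
    using subsetD[OF T.lin_span_superset] by (simp add: list_prod_def pure_tensor_one)
next
  case (Cons g gs a as)
  have cs: "list_prod C cs \<in> carrier C" if "list_all2 (\<lambda>g c. c \<in> G g) hs cs" for hs cs
    using that component_closed by (induction rule: list_all2_induct) (auto simp: list_prod_def)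
  then have S: "?S hs \<subseteq> carrier T" for hs
    by (auto intro!: pure_closed)
  have "a \<otimes>\<^bsub>T\<^esub> list_prod T as \<in> lin_span T (?S (g # gs))"
  proof (rule T.lin_span_mult[OF envelope_generators[of g] S[of gs]])
    show "subspace_of (lin_span T (?S (g # gs))) T"
      by (rule T.lin_span_subspace[OF S])
    show "a \<in> lin_span T {pure x y | x y. x \<in> G g \<and> y \<in> grassmann_component g}"
      using Cons.hyps by (simp add: envelope_component_def)
    fix s t
    assume "s \<in> {pure x y | x y. x \<in> G g \<and> y \<in> grassmann_component g}" "t \<in> ?S gs"
    then obtain x y cs z where *: "s = pure x y" "x \<in> G g" "y \<in> grassmann_component g"
      "t = pure (list_prod C cs) z" "list_all2 (\<lambda>g c. c \<in> G g) gs cs" "z \<in> carrier grassmann_algebra"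
      by blast
    moreover from this have "x \<in> carrier C" "list_prod C cs \<in> carrier C" "y \<in> carrier grassmann_algebra"
      using cs component_closed grassmann_component_closed by blast+
    ultimately have "s \<otimes>\<^bsub>T\<^esub> t = pure (list_prod C (x # cs)) (y \<otimes>\<^bsub>grassmann_algebra\<^esub> z)"
      by (simp add: pure_tensor_mult[OF k_algebra k_algebra_grassmann_algebra] list_prod_def)
    moreover have "list_all2 (\<lambda>g c. c \<in> G g) (g # gs) (x # cs)"
      using * by simp
    moreover have "y \<otimes>\<^bsub>grassmann_algebra\<^esub> z \<in> carrier grassmann_algebra"
      using * grassmann_component_closed by blast
    ultimately have "s \<otimes>\<^bsub>T\<^esub> t \<in> ?S (g # gs)" by blast
    then show "s \<otimes>\<^bsub>T\<^esub> t \<in> lin_span T (?S (g # gs))"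
      by (rule subsetD[OF T.lin_span_superset])
  qed (rule Cons.IH)
  moreover have "list_prod T (a # as) = a \<otimes>\<^bsub>T\<^esub> list_prod T as"
    by (simp add: list_prod_def)
  ultimately show ?case by (simp only:)
qed

end


section \<open>Evaluation of monomials and commutators\<close>

text \<open>The scalar \<open>1\<close> stays in place because \<open>R\<close> is only assumed to
  be an additive monoid; it disappears where a module law is at hand.\<close>

lemma eval_poly_single:
  assumes "abelian_monoid R" "1 \<odot>\<^bsub>R\<^esub> list_prod R (map \<phi> w) \<in> carrier R"
  shows "eval_poly R \<phi> (Poly_Mapping.single w 1) = 1 \<odot>\<^bsub>R\<^esub> list_prod R (map \<phi> w)"
proof -
  interpret abelian_monoid R by fact
  show ?thesis using assms(2) by (simp add: eval_poly_def)
qed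

text \<open>The polynomial \<open>x y - b y x\<close>. With the sign in the coefficient, its value
  is written without subtraction.\<close>

definition q_commutator :: "'x \<Rightarrow> 'x \<Rightarrow> 'k::field \<Rightarrow> 'x list \<Rightarrow>\<^sub>0 'k" where
  "q_commutator x y b = Poly_Mapping.single [x, y] 1 + Poly_Mapping.single [y, x] (- b)"

text \<open>\<open>x \<noteq> y\<close> keeps the two words apart and \<open>b \<noteq> 0\<close>
  keeps the second in the support, so the sum has exactly two terms.\<close>

lemma eval_poly_q_commutator:
  assumes "abelian_monoid R" "x \<noteq> y" "b \<noteq> 0"
    and "1 \<odot>\<^bsub>R\<^esub> list_prod R [\<phi> x, \<phi> y] \<in> carrier R" "(- b) \<odot>\<^bsub>R\<^esub> list_prod R [\<phi> y, \<phi> x] \<in> carrier R"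
  shows "eval_poly R \<phi> (q_commutator x y b)
    = 1 \<odot>\<^bsub>R\<^esub> list_prod R [\<phi> x, \<phi> y] \<oplus>\<^bsub>R\<^esub> (- b) \<odot>\<^bsub>R\<^esub> list_prod R [\<phi> y, \<phi> x]"
proof -
  interpret abelian_monoid R by fact
  have "Poly_Mapping.keys (q_commutator x y b) = {[x, y], [y, x]}"
    using assms(2,3)
    by (auto simp: q_commutator_def in_keys_iff lookup_add lookup_single when_def split: if_splits)
  moreover have "Poly_Mapping.lookup (q_commutator x y b) [x, y] = 1"
    "Poly_Mapping.lookup (q_commutator x y b) [y, x] = - b"
    using assms(2) by (simp_all add: q_commutator_def lookup_add lookup_single when_def)
  ultimately show ?thesis
    using assms(2,4,5) by (simp add: eval_poly_def)
qed

lemma q_commutator_vanishes: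
  assumes "q_commutator (g, 0) (h, 1) b \<in> graded_identities R G"
    and "abelian_monoid R" "b \<noteq> 0" "\<And>k. \<zero>\<^bsub>R\<^esub> \<in> G k" "x \<in> G g" "y \<in> G h"
    and "1 \<odot>\<^bsub>R\<^esub> list_prod R [x, y] \<in> carrier R" "(- b) \<odot>\<^bsub>R\<^esub> list_prod R [y, x] \<in> carrier R"
  shows "1 \<odot>\<^bsub>R\<^esub> list_prod R [x, y] \<oplus>\<^bsub>R\<^esub> (- b) \<odot>\<^bsub>R\<^esub> list_prod R [y, x] = \<zero>\<^bsub>R\<^esub>"
proof -
  \<comment> \<open>The indices \<open>0\<close> and \<open>1\<close> separate the two variables
    even when \<open>g = h\<close>. All other variables take the value zero, which lies in every
    component.\<close>
  let ?\<phi> = "\<lambda>v. if v = (g, 0) then x else if v = (h, 1::nat) then y else \<zero>\<^bsub>R\<^esub>"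
  have "eval_poly R ?\<phi> (q_commutator (g, 0) (h, 1) b) = \<zero>\<^bsub>R\<^esub>"
    using assms(1,4-6) unfolding graded_identities_def by auto
  then show ?thesis
    using eval_poly_q_commutator[of R "(g, 0::nat)" "(h, 1)" b ?\<phi>] assms(2,3,7,8) by simp
qed

lemma q_commutator_in_graded_identities:
  fixes A :: "('k::field, 'a) module"
  assumes gr: "graded_algebra A G" and \<beta>: "commutation_function A G \<beta>"
  shows "q_commutator (g, 0) (h, 1) (\<beta> g h) \<in> graded_identities A G"
proof -
  interpret k_alg A
    using gr by (intro k_alg.intro) (simp add: graded_algebra_def)
  interpret graded_alg A G
    by unfold_locales (rule gr)
  have "eval_poly A \<phi> (q_commutator (g, 0) (h, 1) (\<beta> g h)) = \<zero>\<^bsub>A\<^esub>"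
    if "\<forall>g i. \<phi> (g, i) \<in> G g" for \<phi> :: "bit \<times> nat \<Rightarrow> 'a"
  proof -
    let ?x = "\<phi> (g, 0)" and ?y = "\<phi> (h, 1)"
    have xy: "?x \<in> G g" "?y \<in> G h" "?x \<in> carrier A" "?y \<in> carrier A"
      using that component_closed by blast+
    then have "?x \<otimes>\<^bsub>A\<^esub> ?y = \<beta> g h \<odot>\<^bsub>A\<^esub> (?y \<otimes>\<^bsub>A\<^esub> ?x)" "\<beta> g h \<noteq> 0"
      using \<beta> unfolding commutation_function_def by blast+
    with xy show ?thesis
      using abelian_monoid_axioms
      by (subst eval_poly_q_commutator) (auto simp: list_prod_def smult_uminus r_neg)
  qed
  then show ?thesis
    by (auto simp: graded_identities_def carrier_free_algebra)
qed

section \<open>Passing between identities of the envelope and products in \<open>C\<close>\<close>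

context graded_alg
begin

lemma q_commutator_envelope_imp_commute:
  assumes E: "q_commutator (g, 0) (h, 1) b \<in> graded_identities grassmann_algebra grassmann_component"
    and Env: "q_commutator (g, 0) (h, 1) b \<in> graded_identities Env (envelope_component C G)"
    and b: "b \<noteq> 0" and x: "x \<in> G g" and y: "y \<in> G h"
  shows "x \<otimes> y = y \<otimes> x"
proof -
  let ?E = "grassmann_algebra :: ('k, 'k grassmann) module"
  let ?m = "grassmann_monomial :: nat list \<Rightarrow> 'k grassmann"
  interpret contr: tensor_contraction C ?E grassmann_sign
    by unfold_locales (simp_all add: grassmann_sign_add grassmann_sign_smult)
  \<comment> \<open>Shortest words of the required parities; the letters \<open>0\<close> and
    \<open>1\<close> differ, so that \<open>v @ w\<close> has nonzero sign.\<close>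
  define v w where "v = (if g = 0 then [] else [0::nat])" and "w = (if h = 0 then [] else [1::nat])"
  have vw: "of_nat (length v) = g" "of_nat (length w) = h" "distinct (v @ w)"
    unfolding v_def w_def by (cases g; cases h; simp)+
  let ?s = "word_sign (v @ w) :: 'k" and ?t = "word_sign (w @ v) :: 'k"
  have xy: "x \<in> carrier C" "y \<in> carrier C" using x y component_closed by blast+
  note closed = grassmann_monomial_closed

  have "?m (v @ w) \<oplus>\<^bsub>?E\<^esub> (- b) \<odot>\<^bsub>?E\<^esub> ?m (w @ v) = \<zero>\<^bsub>?E\<^esub>"
    using q_commutator_vanishes[OF E grassmann.abelian_monoid_axioms b
        grassmann.subspace_zero[OF grassmann_component_subspace]
        grassmann_monomial_in_component[OF vw(1)] grassmann_monomial_in_component[OF vw(2)]]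
    by (simp add: list_prod_def closed grassmann_monomial_mult flip: grassmann_monomial_Nil)
  \<comment> \<open>Zero is written as a multiple of a monomial, so that the linearity rules compute
    its sign.\<close>
  then have "grassmann_sign (?m (v @ w) \<oplus>\<^bsub>?E\<^esub> (- b) \<odot>\<^bsub>?E\<^esub> ?m (w @ v)) = grassmann_sign (0 \<odot>\<^bsub>?E\<^esub> ?m [])"
    by (simp add: closed)
  \<comment> \<open>The identity of the Grassmann algebra determines \<open>b\<close> through the
    signs of \<open>v @ w\<close> and \<open>w @ v\<close>.\<close>
  then have st: "?s = b * ?t"
    by (simp only: grassmann_sign_add grassmann_sign_smult closed grassmann.smult_closed
        grassmann_sign_monomial) simp

  have prod: "list_prod T [pure x' (?m v), pure y' (?m w)] = pure (x' \<otimes> y') (?m (v @ w))"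
    if "x' \<in> carrier C" "y' \<in> carrier C" for x' y' v w
    using that by (simp add: list_prod_def pure_closed closed grassmann_monomial_mult
        pure_tensor_mult[OF k_algebra k_algebra_grassmann_algebra])
  have env: "pure (x' \<otimes> y') (?m (v @ w)) \<in> carrier Env"
    if "x' \<in> G (of_nat (length v))" "y' \<in> G (of_nat (length w))" for x' y' v w
  proof -
    have "x' \<otimes> y' \<in> G (of_nat (length (v @ w)))"
      using component_mult[OF that] by (simp only: length_append of_nat_add)
    then show ?thesis
      by (rule subsetD[OF envelope_component_subset pure_in_envelope_component])
         (rule grassmann_monomial_in_component[OF refl])
  qed
  have lp: "list_prod Env [pure x (?m v), pure y (?m w)] = pure (x \<otimes> y) (?m (v @ w))"
    "list_prod Env [pure y (?m w), pure x (?m v)] = pure (y \<otimes> x) (?m (w @ v))"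
    by (simp_all only: envelope_simps prod xy)
  have "pure (x \<otimes> y) (?m (v @ w)) \<in> carrier Env" "pure (y \<otimes> x) (?m (w @ v)) \<in> carrier Env"
    by (rule env; simp only: vw x y)+
  then have lp_closed: "1 \<odot>\<^bsub>Env\<^esub> list_prod Env [pure x (?m v), pure y (?m w)] \<in> carrier Env"
    "(- b) \<odot>\<^bsub>Env\<^esub> list_prod Env [pure y (?m w), pure x (?m v)] \<in> carrier Env"
    unfolding lp unfolding envelope_simps by (auto intro: T.subspace_smult[OF carrier_envelope_subspace])
  have "\<zero>\<^bsub>Env\<^esub> \<in> envelope_component C G k" for k
    unfolding envelope_simps by (rule T.subspace_zero[OF envelope_component_subspace])
  note q_commutator_vanishes[OF Env abelian_monoid_envelope b this
      pure_in_envelope_component[OF x grassmann_monomial_in_component[OF vw(1)]]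
      pure_in_envelope_component[OF y grassmann_monomial_in_component[OF vw(2)]] lp_closed]
  then have "pure (x \<otimes> y) (?m (v @ w)) \<oplus>\<^bsub>T\<^esub> (- b) \<odot>\<^bsub>T\<^esub> pure (y \<otimes> x) (?m (w @ v)) = \<zero>\<^bsub>T\<^esub>"
    unfolding lp unfolding envelope_simps by (simp only: T.smult_one pure_closed m_closed xy closed)
  \<comment> \<open>Contracting the second tensor factor by the sign functional. By
    \<open>st\<close> the two coefficients are opposite, and the nonzero \<open>?s\<close> can be
    divided out.\<close>
  then have "?s \<odot> (x \<otimes> y) \<oplus> (- b * ?t) \<odot> (y \<otimes> x) = \<zero>"
    using contr.pure_tensor_cancel[of "x \<otimes> y" "y \<otimes> x" "?m (v @ w)" "?m (w @ v)" "- b"] xy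
    by (simp add: grassmann_sign_monomial closed)
  then have "?s \<odot> (x \<otimes> y) \<ominus> ?s \<odot> (y \<otimes> x) = \<zero>"
    using xy by (simp add: st smult_uminus minus_eq)
  then have "?s \<odot> (x \<otimes> y) = ?s \<odot> (y \<otimes> x)"
    using xy by simp
  then have "inverse ?s \<odot> (?s \<odot> (x \<otimes> y)) = inverse ?s \<odot> (?s \<odot> (y \<otimes> x))"
    by (rule arg_cong)
  moreover have "?s \<noteq> 0"
    using vw(3) by (rule word_sign_nonzero)
  ultimately show ?thesis
    using xy by (simp add: smult_smult)
qed

text \<open>Contrapositive of the transfer of nonzero products to \<open>C\<close>: every value of
  the monomial is a combination of pure tensors with first factor zero. Numbering the variables by
  position makes them distinct.\<close>

lemma monomial_in_envelope_identities:
  assumes "\<And>cs. list_all2 (\<lambda>g c. c \<in> G g) gs cs \<Longrightarrow> list_prod C cs = \<zero>"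
  shows "Poly_Mapping.single (zip gs [0..<length gs]) 1
    \<in> graded_identities Env (envelope_component C G)"
proof -
  have "eval_poly Env \<phi> (Poly_Mapping.single (zip gs [0..<length gs]) 1) = \<zero>\<^bsub>Env\<^esub>"
    if "\<forall>g i. \<phi> (g, i) \<in> envelope_component C G g" for \<phi> :: "bit \<times> nat \<Rightarrow> _"
  proof -
    let ?w = "zip gs [0..<length gs]"
    have "list_all2 (\<lambda>g a. a \<in> envelope_component C G g) gs (map \<phi> ?w)"
      using that by (simp add: list_all2_conv_all_nth)
    note envelope_list_prod[OF this]
    moreover have "lin_span T {pure (list_prod C cs) y | cs y.
        list_all2 (\<lambda>g c. c \<in> G g) gs cs \<and> y \<in> carrier grassmann_algebra} \<subseteq> {\<zero>\<^bsub>T\<^esub>}"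
    proof (rule T.lin_span_minimal)
      show "subspace_of {\<zero>\<^bsub>T\<^esub>} T" by (rule T.subspaceI) auto
    qed (use assms pure_tensor_zero[OF k_algebra k_algebra_grassmann_algebra] in auto)
    ultimately have "list_prod T (map \<phi> ?w) = \<zero>\<^bsub>T\<^esub>" by blast
    then show ?thesis
      using T.subspace_zero[OF carrier_envelope_subspace]
      by (subst eval_poly_single[OF abelian_monoid_envelope]) (simp_all add: envelope_simps)
  qed
  then show ?thesis
    by (auto simp: graded_identities_def carrier_free_algebra)
qed

end

lemma monomial_not_in_grassmann_identities:
  "Poly_Mapping.single (zip gs [0..<length gs]) (1 :: 'k::field)
    \<notin> graded_identities grassmann_algebra grassmann_component"
proof
  let ?w = "zip gs [0..<length gs]"
  \<comment> \<open>Even variables become the empty word, that is \<open>1\<close>, and the odd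
    variable with index \<open>i\<close> becomes the generator \<open>i\<close>. The value is then a
    monomial in distinct generators.\<close>
  let ?f = "\<lambda>(g::bit, i::nat). if g = 0 then [] else [i]"
  let ?\<phi> = "\<lambda>v. grassmann_monomial (?f v) :: 'k grassmann"
  let ?c = "concat (map ?f ?w)"
  assume *: "Poly_Mapping.single ?w (1 :: 'k) \<in> graded_identities grassmann_algebra grassmann_component"
  have **: "\<forall>g i. ?\<phi> (g, i) \<in> grassmann_component g"
    by (auto intro!: grassmann_monomial_in_component)
  have "eval_poly grassmann_algebra \<phi> (Poly_Mapping.single ?w (1 :: 'k)) = \<zero>\<^bsub>grassmann_algebra\<^esub>"
    if "\<forall>g i. \<phi> (g, i) \<in> grassmann_component g" for \<phi>
    using * that by (simp add: graded_identities_def)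
  note this[OF **]
  then have "grassmann_monomial ?c = (0 :: 'k) \<odot>\<^bsub>grassmann_algebra\<^esub> grassmann_monomial []"
    by (subst (asm) eval_poly_single[OF grassmann.abelian_monoid_axioms])
       (simp_all add: list_prod_grassmann_monomial grassmann_monomial_closed)
  then have "word_sign ?c = (0 :: 'k)"
    by (metis grassmann_sign_monomial grassmann_sign_smult grassmann_monomial_closed mult_zero_left)
  \<comment> \<open>The inclusion in the set of indices is what lets the induction conclude that a
    newly added letter has not occurred.\<close>
  moreover have "distinct (concat (map ?f w)) \<and> set (concat (map ?f w)) \<subseteq> snd ` set w"
    if "distinct (map snd w)" for w
    using that by (induction w) (auto split: if_splits)
  from this[of ?w] have "distinct ?c" by simp
  ultimately show False
    using word_sign_nonzero by blast
qed

theorem lemma21: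
  fixes A :: "('k::{alg_closed_field, field_char_0}, 'a) module"
    and C :: "('k, 'c) module"
    and GA :: "bit \<Rightarrow> 'a set"
    and GC :: "bit \<Rightarrow> 'c set"
  assumes "regular A GA"
    and "minimal_decomposition A GA"
    and "graded_algebra C GC"
    and "finite_dim C"
    and "graded_identities (grassmann_envelope C GC) (envelope_component C GC)
           = graded_identities A GA"
    and "graded_identities A GA
           = graded_identities (grassmann_algebra :: ('k, 'k grassmann) module) grassmann_component"
  shows "regular C GC \<and> cring C"
proof -
  interpret C: graded_alg C GC
    using assms(3) by unfold_locales (auto simp: graded_algebra_def)
  obtain \<beta> where A: "graded_algebra A GA" and \<beta>: "commutation_function A GA \<beta>"
    using assms(1) by (auto simp: regular_def)
  \<comment> \<open>The commutation relation of \<open>A\<close> is one of its graded identities, so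
    the two equalities of identity ideals carry it to both the envelope and the Grassmann
    algebra.\<close>
  have comm: "x \<otimes>\<^bsub>C\<^esub> y = y \<otimes>\<^bsub>C\<^esub> x" if "x \<in> GC g" "y \<in> GC h" for x y g h
  proof (rule C.q_commutator_envelope_imp_commute)
    show "\<beta> g h \<noteq> 0" using \<beta> by (simp add: commutation_function_def)
  qed (use q_commutator_in_graded_identities[OF A \<beta>, of g h] assms(5,6) that in auto)

  \<comment> \<open>If all such products vanished, the monomial with these degrees would be an
    identity of the envelope, hence of the Grassmann algebra.\<close>
  have "\<exists>cs. list_all2 (\<lambda>g c. c \<in> GC g) gs cs \<and> list_prod C cs \<noteq> \<zero>\<^bsub>C\<^esub>" for gs
  proof (rule ccontr)
    assume "\<not> ?thesis"
    then have "Poly_Mapping.single (zip gs [0..<length gs]) 1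
        \<in> graded_identities (grassmann_envelope C GC) (envelope_component C GC)"
      by (intro C.monomial_in_envelope_identities) blast
    then show False
      using monomial_not_in_grassmann_identities[of gs, where 'k = 'k] by (simp only: assms(5,6))
  qed
  moreover have "commutation_function C GC (\<lambda>_ _. 1)"
    unfolding commutation_function_def
  proof (intro allI conjI ballI)
    fix g h x y assume xy: "x \<in> GC g" "y \<in> GC h"
    show "x \<otimes>\<^bsub>C\<^esub> y = 1 \<odot>\<^bsub>C\<^esub> (y \<otimes>\<^bsub>C\<^esub> x)"
      unfolding comm[OF xy] using xy[THEN C.component_closed] by simp
  qed simp
  ultimately have "regular C GC"
    unfolding regular_def using assms(3) by blast
  moreover have "cring C"
  proof (intro cring.intro C.ring_axioms C.monoid_comm_monoidI)
    fix x y assume "x \<in> carrier C" "y \<in> carrier C"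
    then obtain x0 x1 y0 y1 where "x0 \<in> GC 0" "x1 \<in> GC 1" "x = x0 \<oplus>\<^bsub>C\<^esub> x1"
      "y0 \<in> GC 0" "y1 \<in> GC 1" "y = y0 \<oplus>\<^bsub>C\<^esub> y1"
      by (meson C.decomposition)
    moreover from this have "x0 \<in> carrier C" "x1 \<in> carrier C" "y0 \<in> carrier C" "y1 \<in> carrier C"
      using C.component_closed by blast+
    \<comment> \<open>Commutativity is known for homogeneous elements only, so it is applied to the
      four products of components.\<close>
    moreover from calculation have "x0 \<otimes>\<^bsub>C\<^esub> y0 = y0 \<otimes>\<^bsub>C\<^esub> x0" "x0 \<otimes>\<^bsub>C\<^esub> y1 = y1 \<otimes>\<^bsub>C\<^esub> x0"
      "x1 \<otimes>\<^bsub>C\<^esub> y0 = y0 \<otimes>\<^bsub>C\<^esub> x1" "x1 \<otimes>\<^bsub>C\<^esub> y1 = y1 \<otimes>\<^bsub>C\<^esub> x1"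
      by (meson comm)+
    ultimately show "x \<otimes>\<^bsub>C\<^esub> y = y \<otimes>\<^bsub>C\<^esub> x"
      by (simp add: C.l_distr C.r_distr C.a_ac)
  qed
  ultimately show ?thesis by blast
qed

end
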